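(* Let $r\ge1$ and let $k_0,\dots,k_r$ be nonnegative integers, and put $n=1+k_0+\cdots+k_r$. The number of $r$-permutations $\pi$ of $[n]$ such that $S(S(\pi))$ is the identity permutation $12\cdots n$ and such that $\pi$ has exactly $k_i$ descents of type $i$ for each $i=0,\dots,r$, equals $$\frac{1}{n^2}\prod_{i=0}^r\frac{n}{n-k_i}\binom{2n-1-k_i}{k_i}.$$
   Context: An $r$-permutation of a finite set $A$ of positive integers is a word in which each element of $A$ appears exactly $r$ times such that whenever $i<j<k$ and $a_i=a_k$ we have $a_j\le a_i$; for $A=[n]$ it is an $r$-permutation of $[n]$. Stack sorting $S$: on words with distinct letters, $S(\emptyset)=\emptyset$ and $S(\pi_lm\pi_r)=S(\pi_l)S(\pi_r)m$ where $m$ is the largest letter; on a nonempty $r$-permutation $\pi$ with largest letter $m$, written $\pi=\alpha_1m\alpha_2m\cdots m\alpha_{r+1}$, $S(\pi)=S(\alpha_1)\cdots S(\alpha_{r+1})m$ (a word with distinct letters), and $S(\emptyset)=\emptyset$. A letter $a$ of $\pi$ is a type $i$ descent ($1\le i\le r$) if the $i$th occurrence of $a$ is immediately followed by a smaller letter, and a type $0$ descent if the first occurrence of $a$ immediately follows a smaller letter. *)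

theory Defs
  imports Complex_Main
begin

definition r_permutation :: "nat \<Rightarrow> nat set \<Rightarrow> nat list \<Rightarrow> bool" where
  "r_permutation r A w \<longleftrightarrow>
     set w \<subseteq> A \<and> (\<forall>a\<in>A. count_list w a = r) \<and>
     (\<forall>i j k. i < j \<and> j < k \<and> k < length w \<and> w ! i = w ! k \<longrightarrow> w ! j \<le> w ! i)"

(* The (possibly empty) factors of a word between the occurrences of m:
   \<alpha>1 m \<alpha>2 m ... m \<alpha>l is sent to [\<alpha>1, ..., \<alpha>l]. *)
primrec blocks :: "nat \<Rightarrow> nat list \<Rightarrow> nat list list" where
  "blocks m [] = [[]]"
| "blocks m (x # xs) =
     (if x = m then [] # blocks m xs
      else (x # hd (blocks m xs)) # tl (blocks m xs))"

lemma blocks_not_Nil [simp]: "blocks m xs \<noteq> []"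
  by (cases xs) auto

lemma blocks_no_occurrence: "m \<notin> set u \<Longrightarrow> blocks m u = [u]"
  by (induction u) auto

lemma blocks_append: "m \<notin> set u \<Longrightarrow> blocks m (u @ m # w) = u # blocks m w"
  by (induction u) auto

lemma blocks_length_le: "b \<in> set (blocks m xs) \<Longrightarrow> length b \<le> length xs"
proof (induction xs arbitrary: b)
  case (Cons x xs)
  have "length (hd (blocks m xs)) \<le> length xs"
    by (intro Cons.IH) simp
  moreover have "c \<in> set (tl (blocks m xs)) \<Longrightarrow> length c \<le> length xs" for c
    by (intro Cons.IH) (meson list.set_sel(2) blocks_not_Nil)
  ultimately show ?case
    using Cons by (fastforce split: if_splits)
qed simp

lemma blocks_length_less:
  "m \<in> set xs \<Longrightarrow> b \<in> set (blocks m xs) \<Longrightarrow> length b < length xs"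
proof (induction xs arbitrary: b)
  case (Cons x xs)
  show ?case
  proof (cases "x = m")
    case True
    then show ?thesis using Cons.prems by (auto dest: blocks_length_le)
  next
    case False
    then have m: "m \<in> set xs" using Cons.prems by simp
    have "length (hd (blocks m xs)) < length xs"
      by (intro Cons.IH m) simp
    moreover have "c \<in> set (tl (blocks m xs)) \<Longrightarrow> length c < length xs" for c
      by (intro Cons.IH m) (meson list.set_sel(2) blocks_not_Nil)
    ultimately show ?thesis
      using Cons.prems False by fastforce
  qed
qed simp

(* A single function serves both for words with distinct letters and for r-permutations:
   the former are the 1-permutations, whose largest letter splits them into two blocks
   (see stack_sort_distinct below). On an r-permutation there are r + 1 blocks. *)
function stack_sort :: "nat list \<Rightarrow> nat list" where
  "stack_sort w =
     (if w = [] then []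
      else concat (map stack_sort (blocks (Max (set w)) w)) @ [Max (set w)])"
  by auto
termination
  by (relation "measure length") (auto intro!: blocks_length_less[where m = "Max (set w)" for w] simp: Max_in)

declare stack_sort.simps [simp del]

lemma stack_sort_Nil: "stack_sort [] = []"
  by (simp add: stack_sort.simps)

lemma stack_sort_distinct:
  assumes "\<forall>x \<in> set u \<union> set v. x < m"
  shows "stack_sort (u @ m # v) = stack_sort u @ stack_sort v @ [m]"
proof -
  have "Max (set (u @ m # v)) = m"
    using assms by (intro Max_eqI) (auto intro: less_imp_le)
  moreover have "m \<notin> set u" "m \<notin> set v"
    using assms by auto
  ultimately show ?thesis
    by (subst stack_sort.simps) (simp add: blocks_append blocks_no_occurrence)
qed

(* Positions are numbered from 0, occurrences from 1. *)
definition occurrence_at :: "nat list \<Rightarrow> nat \<Rightarrow> nat \<Rightarrow> nat \<Rightarrow> bool" where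
  "occurrence_at w a i p \<longleftrightarrow>
     p < length w \<and> w ! p = a \<and> count_list (take p w) a + 1 = i"

definition type_descent :: "nat list \<Rightarrow> nat \<Rightarrow> nat \<Rightarrow> bool" where
  "type_descent w i a \<longleftrightarrow>
     (if i = 0 then \<exists>p. occurrence_at w a 1 (Suc p) \<and> w ! p < a
      else \<exists>p. occurrence_at w a i p \<and> Suc p < length w \<and> w ! Suc p < a)"

end

theory Submission
  imports Defs
    "HOL-Computational_Algebra.Formal_Laurent_Series"
    "HOL-Computational_Algebra.Polynomial"
    "HOL-Library.FuncSet"
begin

text \<open>
  An \<open>r\<close>-permutation is a decreasing tree whose nodes have optional children of types \<open>0, \<dots>, r\<close>; type \<open>i\<close>
  descents are the edges of type \<open>i\<close>, and stack sorting reads the tree in postorder. So one counts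
  trees with edge weights \<open>x\<^sub>0, \<dots>, x\<^sub>r\<close> whose postorder word avoids 231. Splitting such a word at its
  maximum as \<open>p m q\<close> with \<open>p < q\<close>, the generating function \<open>F(z, u)\<close> of forests (\<open>z\<close> marks nodes, \<open>u\<close> marks trees)
  satisfies \<open>F = 1 + z u F H\<close>, where \<open>H\<close> is the part with nonnegative powers of \<open>u\<close> of
  \<open>F \<Prod>(1 + x\<^sub>i / u)\<close>.

  This is solved by a Wiener-Hopf factorization of the kernel. Let \<open>B\<^sub>i\<^sup>2 = B\<^sub>i + x\<^sub>i s\<close> with \<open>s = z \<Prod>B\<^sub>i\<^sup>2\<close>,
  \<open>a\<^sub>i = 1 - 1 / B\<^sub>i\<close> and \<open>v = u s (1 + v)\<^sup>2\<close>. Then \<open>1 + x\<^sub>i / u = B\<^sub>i\<^sup>2 (1 + a\<^sub>i v) (1 + a\<^sub>i / v)\<close>, and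
  \<open>F = (1 + v) / \<Prod>(1 + a\<^sub>i v)\<close> is the solution because \<open>z u F \<Prod>(1 + x\<^sub>i / u) + 1 / F\<close> is symmetric
  under \<open>v \<mapsto> 1 / v\<close>, hence a polynomial in \<open>1 / u\<close>. The coefficient \<open>F\<^sub>1\<close> of \<open>u\<close> satisfies \<open>z F\<^sub>1' = s\<close>,
  and Lagrange inversion for \<open>s\<close> together with the Lucas polynomials for powers of \<open>B\<^sub>i\<close> gives the
  product formula.
\<close>

section \<open>Words, blocks and descents\<close>

lemma set_stack_sort [simp]: "set (stack_sort w) = set w"
proof (induction w rule: length_induct)
  case (1 w)
  show ?case
  proof (cases "w = []")
    case False
    let ?m = "Max (set w)"
    have m: "?m \<in> set w" using False by (simp add: Max_in)
    have b: "(\<Union>b\<in>set (blocks k u). set b) = set u - {k}" for k u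
    proof (induction u)
      case (Cons y u)
      have "blocks k u = hd (blocks k u) # tl (blocks k u)" by simp
      then have "(\<Union>b\<in>set (blocks k u). set b) = set (hd (blocks k u)) \<union> (\<Union>b\<in>set (tl (blocks k u)). set b)"
        by (metis UN_insert list.simps(15))
      then show ?case using Cons by auto
    qed simp
    have "set (stack_sort w) = insert ?m (\<Union>b\<in>set (blocks ?m w). set (stack_sort b))"
      using False by (subst stack_sort.simps) simp
    also have "(\<Union>b\<in>set (blocks ?m w). set (stack_sort b)) = (\<Union>b\<in>set (blocks ?m w). set b)"
      using 1 blocks_length_less[OF m] by simp
    also have "insert ?m \<dots> = set w"
      using m b by auto
    finally show ?thesis .
  qed (simp add: stack_sort_Nil)
qed

lemma stack_sort_eq_Nil [simp]: "stack_sort w = [] \<longleftrightarrow> w = []"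
  using set_stack_sort[of w] by (metis set_empty2)

section \<open>Splitting a word at a letter and joining it back\<close>

text \<open>Inverse of \<open>blocks m\<close> on nonempty lists of words avoiding \<open>m\<close>:
  it rebuilds a decreasing tree from the subtrees of its root.\<close>

fun join :: "nat \<Rightarrow> nat list list \<Rightarrow> nat list" where
  "join m [] = []"
| "join m [u] = u"
| "join m (u # us) = u @ m # join m us"

lemma join_Cons: "us \<noteq> [] \<Longrightarrow> join m (u # us) = u @ m # join m us"
  by (cases us) auto

lemma set_join: "set (join m us) = (\<Union>u\<in>set us. set u) \<union> (if length us > 1 then {m} else {})"
  by (induction m us rule: join.induct) auto

lemma join_blocks: "join m (blocks m w) = w"
proof (induction w)
  case (Cons y w)
  obtain u us where us: "blocks m w = u # us"
    by (meson blocks_not_Nil neq_Nil_conv)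
  show ?case
    using Cons by (cases us) (auto simp: us)
qed simp

lemma blocks_join:
  "us \<noteq> [] \<Longrightarrow> \<forall>u\<in>set us. m \<notin> set u \<Longrightarrow> blocks m (join m us) = us"
  by (induction m us rule: join.induct) (auto simp: blocks_no_occurrence blocks_append)

lemma length_blocks: "length (blocks m w) = count_list w m + 1"
  by (induction w) auto

lemma notin_blocks: "u \<in> set (blocks m w) \<Longrightarrow> m \<notin> set u"
proof (induction w arbitrary: u)
  case (Cons y w)
  have "m \<notin> set (hd (blocks m w))"
    by (rule Cons.IH) simp
  moreover have "v \<in> set (tl (blocks m w)) \<Longrightarrow> m \<notin> set v" for v
    by (rule Cons.IH) (meson list.set_sel(2) blocks_not_Nil)
  ultimately show ?case
    using Cons by (fastforce split: if_splits)
qed simp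

lemma count_join: "a \<noteq> m \<Longrightarrow> count_list (join m us) a = (\<Sum>u\<leftarrow>us. count_list u a)"
  by (induction m us rule: join.induct) auto

section \<open>The nesting condition and disjointness of blocks\<close>

text \<open>The pattern condition of \<open>r_permutation\<close> alone; it passes to factors, while
  the letter multiplicities do not.\<close>

definition nested :: "nat list \<Rightarrow> bool" where
  "nested w \<longleftrightarrow> (\<forall>i j k. i < j \<and> j < k \<and> k < length w \<and> w ! i = w ! k \<longrightarrow> w ! j \<le> w ! i)"

lemma nested_factor:
  assumes "nested (p @ w @ q)"
  shows "nested w"
  unfolding nested_def
proof (intro allI impI)
  fix i j k assume *: "i < j \<and> j < k \<and> k < length w \<and> w ! i = w ! k"
  define l where "l = length p"
  have "(p @ w @ q) ! (l + t) = w ! t" if "t < length w" for t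
    using that by (simp add: l_def nth_append)
  note shift = this
  have "l + i < l + j \<and> l + j < l + k \<and> l + k < length (p @ w @ q) \<and> (p @ w @ q) ! (l + i) = (p @ w @ q) ! (l + k)"
    using * shift[of i] shift[of k] by (simp add: l_def)
  then have "(p @ w @ q) ! (l + j) \<le> (p @ w @ q) ! (l + i)"
    using assms(1) unfolding nested_def by blast
  then show "w ! j \<le> w ! i"
    using * shift[of i] shift[of j] by simp
qed

text \<open>Two copies of \<open>a\<close> around \<open>m\<close> put \<open>m\<close> in the
  middle of the pattern. For a maximal \<open>m\<close> this forces the blocks around it to have
  disjoint letters.\<close>

lemma nested_separates:
  assumes "nested (p @ m # q)" "a \<in> set p" "a \<in> set q"
  shows "m \<le> a"
proof -
  obtain i j where i: "i < length p" "p ! i = a" and j: "j < length q" "q ! j = a"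
    using assms by (auto simp: in_set_conv_nth)
  have "(p @ m # q) ! length p \<le> (p @ m # q) ! i"
    using assms(1) i j unfolding nested_def
    by (elim allE[of _ i] allE[of _ "length p"] allE[of _ "length p + Suc j"]) (auto simp: nth_append)
  then show ?thesis
    using i by (simp add: nth_append)
qed

text \<open>Equal letters at \<open>i\<close> and \<open>k\<close> cannot lie on different sides of
  the end of \<open>p\<close>. So both lie in \<open>p\<close>, or both in \<open>q\<close>, or
  position \<open>i\<close> holds the separator, which bounds every letter.\<close>

lemma nested_append:
  assumes "nested p" "nested q" "set p \<inter> set (m # q) = {}" "\<forall>a\<in>set p. a \<le> m" "\<forall>a\<in>set q. a \<le> m"
  shows "nested (p @ m # q)"
  unfolding nested_def
proof (intro allI impI)
  fix i j k
  let ?w = "p @ m # q"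
  let ?l = "length p"
  assume *: "i < j \<and> j < k \<and> k < length ?w \<and> ?w ! i = ?w ! k"
  have in_q: "?w ! t \<in> set (m # q)" if "?l \<le> t" "t < length ?w" for t
    using that by (metis append_Nil2 length_append less_diff_conv2 nth_append not_less nth_mem add.commute)
  have in_p: "?w ! t \<in> set p" if "t < ?l" for t
    using that by (simp add: nth_append)
  have le: "?w ! t \<le> m" if "t < length ?w" for t
    using in_p[of t] in_q[of t] assms that by (cases "t < ?l") auto
  consider "k < ?l" | "i < ?l" "?l \<le> k" | "i = ?l" | "?l < i" by linarith
  then show "?w ! j \<le> ?w ! i"
  proof cases
    case 1
    have l: "i < length p" "j < length p"
      using * 1 by linarith+
    then have "i < j \<and> j < k \<and> k < length p \<and> p ! i = p ! k"
      using * 1 l by (simp add: nth_append)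
    then have "p ! j \<le> p ! i"
      using assms(1) unfolding nested_def by blast
    then show ?thesis
      using l by (simp add: nth_append)
  next
    case 2
    then show ?thesis
      using in_p[of i] in_q[of k] * assms(3) by auto
  next
    case 3
    then show ?thesis using le[of j] * by simp
  next
    case 4
    define i' j' k' where "i' = i - Suc ?l" and "j' = j - Suc ?l" and "k' = k - Suc ?l"
    have ijk: "i = Suc ?l + i'" "j = Suc ?l + j'" "k = Suc ?l + k'"
      using 4 * by (auto simp: i'_def j'_def k'_def)
    have "i' < j' \<and> j' < k' \<and> k' < length q \<and> q ! i' = q ! k'"
      using * unfolding ijk by (simp add: nth_append)
    then have "q ! j' \<le> q ! i'"
      using assms(2) unfolding nested_def by blast
    then show ?thesis
      by (simp add: ijk nth_append)
  qed
qed

text \<open>The letter set is left free because the blocks of an \<open>r\<close>-permutation are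
  again of this kind, over smaller sets.\<close>

abbreviation multiperm :: "nat \<Rightarrow> nat list \<Rightarrow> bool" where
  "multiperm r w \<equiv> r_permutation r (set w) w"

lemma multiperm_iff: "multiperm r w \<longleftrightarrow> nested w \<and> (\<forall>a\<in>set w. count_list w a = r)"
  unfolding r_permutation_def nested_def by blast

text \<open>Disjointness between positions rather than between elements, so that the empty word may
  be repeated, as empty blocks are.\<close>

fun disjoint_words :: "nat list list \<Rightarrow> bool" where
  "disjoint_words [] \<longleftrightarrow> True"
| "disjoint_words (u # us) \<longleftrightarrow> (\<forall>v\<in>set us. set u \<inter> set v = {}) \<and> disjoint_words us"

lemma disjoint_words_stack_sort:
  "distinct (concat (map stack_sort us)) \<longleftrightarrow> (\<forall>u\<in>set us. distinct (stack_sort u)) \<and> disjoint_words us"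
  by (induction us) auto

lemma disjoint_words_nth:
  "disjoint_words us \<Longrightarrow> i < length us \<Longrightarrow> j < length us \<Longrightarrow> i \<noteq> j \<Longrightarrow> set (us ! i) \<inter> set (us ! j) = {}"
proof (induction us arbitrary: i j)
  case (Cons u us)
  have "set u \<inter> set (us ! l) = {}" "set (us ! l) \<inter> set u = {}" if "l < length us" for l
    using Cons.prems(1) that nth_mem[OF that] by auto
  then show ?case
    using Cons by (cases i; cases j) simp_all
qed simp

lemma count_list_disjoint:
  "disjoint_words us \<Longrightarrow> u \<in> set us \<Longrightarrow> a \<in> set u \<Longrightarrow> (\<Sum>u\<leftarrow>us. count_list u a) = count_list u a"
proof (induction us)
  case (Cons v us)
  have 0: "(\<Sum>u\<leftarrow>us. count_list u a) = 0" if "\<forall>u\<in>set us. a \<notin> set u"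
    using that by (induction us) auto
  show ?case
  proof (cases "u \<in> set us")
    case True
    then have "a \<notin> set v" using Cons.prems by auto
    then show ?thesis using Cons True by simp
  next
    case False
    then have "u = v" using Cons.prems by auto
    moreover have "\<forall>u\<in>set us. a \<notin> set u" using Cons.prems \<open>u = v\<close> by auto
    ultimately show ?thesis by (simp add: 0)
  qed
qed simp

lemma nested_join_imp_nested: "nested (join m us) \<Longrightarrow> u \<in> set us \<Longrightarrow> nested u"
proof (induction m us rule: join.induct)
  case (3 m u' v us)
  have "nested u'" "nested (join m (v # us))"
    using nested_factor[of "[]" u' "m # join m (v # us)"] nested_factor[of "u' @ [m]" "join m (v # us)" "[]"] 3
    by auto
  then show ?case using 3 by auto
qed auto

lemma nested_join_imp_disjoint:
  "nested (join m us) \<Longrightarrow> \<forall>u\<in>set us. \<forall>a\<in>set u. a < m \<Longrightarrow> disjoint_words us"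
proof (induction m us rule: join.induct)
  case (3 m u v us)
  have "nested (join m (v # us))"
    using nested_factor[of "u @ [m]" "join m (v # us)" "[]"] 3 by auto
  moreover have "set u \<inter> set w = {}" if "w \<in> set (v # us)" for w
    using nested_separates[of u m "join m (v # us)"] 3 that by (fastforce simp: set_join)
  ultimately show ?case using 3 by auto
qed auto

lemma nested_join:
  "\<forall>u\<in>set us. nested u \<Longrightarrow> \<forall>u\<in>set us. \<forall>a\<in>set u. a < m \<Longrightarrow> disjoint_words us \<Longrightarrow> nested (join m us)"
proof (induction m us rule: join.induct)
  case (3 m u v us)
  have m: "\<forall>a\<in>set u. a < m" and q: "set (join m (v # us)) \<subseteq> insert m (\<Union>w\<in>set (v # us). set w)"
    using 3(3) by (auto simp: set_join split: if_splits)
  have "nested (u @ m # join m (v # us))"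
  proof (rule nested_append)
    show "nested (join m (v # us))"
      using 3 by simp
    have "set u \<inter> (\<Union>w\<in>set (v # us). set w) = {}" "m \<notin> set u"
      using 3(4) m by auto
    then show "set u \<inter> set (m # join m (v # us)) = {}"
      using q by auto
    show "\<forall>a\<in>set (join m (v # us)). a \<le> m"
    proof
      fix a assume "a \<in> set (join m (v # us))"
      then have "a = m \<or> (\<exists>w\<in>set (v # us). a \<in> set w)"
        using q by blast
      then show "a \<le> m"
        using 3(3) by (meson less_imp_le list.set_intros(2) order_refl)
    qed
    show "\<forall>a\<in>set u. a \<le> m"
      using m by (simp add: less_imp_le)
    show "nested u"
      using 3(2) by simp
  qed
  then show ?case by simp
qed (auto simp: nested_def)

text \<open>The \<open>r + 1\<close> entries leave exactly \<open>r\<close> separators, and by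
  disjointness every other letter has all its copies in one block.\<close>

lemma multiperm_join_iff:
  assumes "length us = Suc r" "r \<ge> 1" "\<forall>u\<in>set us. \<forall>a\<in>set u. a < m" "disjoint_words us"
  shows "multiperm r (join m us) \<longleftrightarrow> (\<forall>u\<in>set us. multiperm r u)"
proof -
  have us: "us \<noteq> []" using assms by auto
  have "blocks m (join m us) = us"
    using assms us by (intro blocks_join) auto
  then have m: "count_list (join m us) m = r"
    using length_blocks[of m "join m us"] assms by simp
  have "count_list (join m us) a = count_list u a" if "u \<in> set us" "a \<in> set u" for u a
    using that assms count_list_disjoint[of us u a] by (subst count_join) auto
  then have "(\<forall>a\<in>set (join m us). count_list (join m us) a = r) \<longleftrightarrow> (\<forall>u\<in>set us. \<forall>a\<in>set u. count_list u a = r)"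
    using m by (auto simp: set_join)
  moreover have "nested (join m us) \<longleftrightarrow> (\<forall>u\<in>set us. nested u)"
    using assms nested_join nested_join_imp_nested by metis
  ultimately show ?thesis
    unfolding multiperm_iff by blast
qed

text \<open>The tree structure: the largest letter is the root, and the \<open>r + 1\<close> blocks
  are its possibly empty subtrees, of types 0 to \<open>r\<close>.\<close>

lemma multiperm_blocks:
  assumes "multiperm r w" "w \<noteq> []" "r \<ge> 1"
  defines "m \<equiv> Max (set w)"
  shows "length (blocks m w) = Suc r" "\<forall>u\<in>set (blocks m w). \<forall>a\<in>set u. a < m"
    "disjoint_words (blocks m w)" "\<forall>u\<in>set (blocks m w). multiperm r u"
proof -
  have "m \<in> set w" using assms by (simp add: Max_in)
  then show 1: "length (blocks m w) = Suc r"
    using assms(1) by (simp add: length_blocks multiperm_iff)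
  have "a < m" if "u \<in> set (blocks m w)" "a \<in> set u" for u a
  proof -
    have "a \<in> set (join m (blocks m w))"
      using that by (auto simp: set_join)
    then have "a \<le> m"
      by (simp add: join_blocks m_def)
    then show ?thesis
      using notin_blocks that by (metis le_neq_implies_less)
  qed
  then show 2: "\<forall>u\<in>set (blocks m w). \<forall>a\<in>set u. a < m" by blast
  show 3: "disjoint_words (blocks m w)"
    using nested_join_imp_disjoint[of m "blocks m w"] 2 assms(1) by (simp add: join_blocks multiperm_iff)
  show "\<forall>u\<in>set (blocks m w). multiperm r u"
    using multiperm_join_iff[OF 1 \<open>r \<ge> 1\<close> 2 3] assms(1) by (simp add: join_blocks)
qed

lemma distinct_stack_sort_multiperm: "multiperm r w \<Longrightarrow> r \<ge> 1 \<Longrightarrow> distinct (stack_sort w)"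
proof (induction w rule: length_induct)
  case (1 w)
  show ?case
  proof (cases "w = []")
    case False
    let ?m = "Max (set w)"
    have "?m \<in> set w" using False by (simp add: Max_in)
    note b = multiperm_blocks[OF "1.prems"(1) False "1.prems"(2)]
    have "distinct (concat (map stack_sort (blocks ?m w)))"
      using b 1 blocks_length_less[OF \<open>?m \<in> set w\<close>] by (auto simp: disjoint_words_stack_sort)
    then show ?thesis
      using False b(2) by (subst stack_sort.simps) auto
  qed (simp add: stack_sort_Nil)
qed

section \<open>Descents of a joined word\<close>

lemma occurrence_at_unique:
  assumes "occurrence_at w a i p" "occurrence_at w a i q"
  shows "p = q"
proof -
  have less: "count_list (take p w) a < count_list (take q w) a" if "p < q" "q \<le> length w" "w ! p = a" for p q
  proof -
    have "take q w = take p w @ w ! p # drop (Suc p) (take q w)"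
      using that id_take_nth_drop[of p "take q w"] by simp
    then have "count_list (take q w) a = count_list (take p w @ w ! p # drop (Suc p) (take q w)) a"
      by (rule arg_cong)
    then show ?thesis using that by simp
  qed
  show ?thesis
    using assms less[of p q] less[of q p] unfolding occurrence_at_def
    by (cases p q rule: linorder_cases) auto
qed

lemma type_descent_in_set: "type_descent w i a \<Longrightarrow> a \<in> set w"
  by (auto simp: type_descent_def occurrence_at_def split: if_splits)

lemma type_descent_Nil [simp]: "\<not> type_descent [] i a"
  using type_descent_in_set by fastforce

lemma occurrence_at_append:
  assumes "a \<notin> set p" "a \<notin> set q"
  shows "occurrence_at (p @ w @ q) a i t \<longleftrightarrow> length p \<le> t \<and> occurrence_at w a i (t - length p)"
proof (cases "length p \<le> t \<and> t < length p + length w")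
  case True
  then show ?thesis
    using assms by (auto simp: occurrence_at_def nth_append)
next
  case False
  have "(p @ w @ q) ! t \<noteq> a" if "t < length (p @ w @ q)"
  proof (cases "t < length p")
    case True
    then show ?thesis using assms(1) by (auto simp: nth_append)
  next
    case 2: False
    have "t - length p - length w < length q"
      using that False 2 by simp
    then have "q ! (t - length p - length w) \<in> set q"
      by (rule nth_mem)
    then show ?thesis
      using assms(2) False 2 by (auto simp: nth_append)
  qed
  then show ?thesis
    using False by (auto simp: occurrence_at_def)
qed

text \<open>Since \<open>a\<close> is absent outside \<open>w\<close>, its occurrences keep their
  numbers. The letters next to \<open>w\<close> exceed \<open>a\<close>, so they create no descent
  of \<open>a\<close>.\<close>

lemma type_descent_factor:
  assumes "a \<notin> set p" "a \<notin> set q" "p = [] \<or> last p > a" "q = [] \<or> hd q > a"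
  shows "type_descent (p @ w @ q) i a \<longleftrightarrow> type_descent w i a"
proof (cases "i = 0")
  case True
  have "(\<exists>t. occurrence_at (p @ w @ q) a 1 (Suc t) \<and> (p @ w @ q) ! t < a) \<longleftrightarrow>
      (\<exists>t. occurrence_at w a 1 (Suc t) \<and> w ! t < a)" (is "?L \<longleftrightarrow> ?R")
  proof
    assume ?L
    then obtain t where t: "occurrence_at (p @ w @ q) a 1 (Suc t)" "(p @ w @ q) ! t < a" by blast
    then have t': "length p \<le> Suc t" "occurrence_at w a 1 (Suc t - length p)"
      using assms by (auto simp: occurrence_at_append)
    have "length p \<noteq> Suc t"
    proof
      assume *: "length p = Suc t"
      then have "(p @ w @ q) ! t = last p"
        by (simp add: nth_append last_conv_nth flip: length_0_conv)
      then show False using assms(3) t(2) * by auto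
    qed
    then have le: "length p \<le> t" using t' by simp
    then have "t - length p < length w"
      using t'(2) by (auto simp: occurrence_at_def)
    then have "w ! (t - length p) < a"
      using t(2) le by (simp add: nth_append)
    then show ?R
      using t'(2) le by (metis Suc_diff_le)
  next
    assume ?R
    then obtain t where t: "occurrence_at w a 1 (Suc t)" "w ! t < a" by blast
    then have "occurrence_at (p @ w @ q) a 1 (Suc (length p + t)) \<and> (p @ w @ q) ! (length p + t) < a"
      using assms by (simp add: occurrence_at_append nth_append) (auto simp: occurrence_at_def)
    then show ?L by blast
  qed
  then show ?thesis
    by (simp add: type_descent_def True)
next
  case False
  have "(\<exists>t. occurrence_at (p @ w @ q) a i t \<and> Suc t < length (p @ w @ q) \<and> (p @ w @ q) ! Suc t < a) \<longleftrightarrow>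
      (\<exists>t. occurrence_at w a i t \<and> Suc t < length w \<and> w ! Suc t < a)" (is "?L \<longleftrightarrow> ?R")
  proof
    assume ?L
    then obtain t where t: "occurrence_at (p @ w @ q) a i t" "Suc t < length (p @ w @ q)" "(p @ w @ q) ! Suc t < a" by blast
    then have t': "length p \<le> t" "occurrence_at w a i (t - length p)"
      using assms by (auto simp: occurrence_at_append)
    have lt: "t - length p < length w"
      using t'(2) by (simp add: occurrence_at_def)
    have "Suc (t - length p) \<noteq> length w"
    proof
      assume "Suc (t - length p) = length w"
      then have "Suc t = length p + length w" using t' by simp
      then have "(p @ w @ q) ! Suc t = hd q" "q \<noteq> []"
        using t(2) by (auto simp: nth_append hd_conv_nth)
      then show False using assms(4) t(3) by auto
    qed
    then have *: "Suc (t - length p) < length w" using lt by simp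
    then have "w ! Suc (t - length p) < a"
      using t(3) t'(1) by (simp add: nth_append Suc_diff_le)
    then show ?R
      using t'(2) * by blast
  next
    assume ?R
    then obtain t where t: "occurrence_at w a i t" "Suc t < length w" "w ! Suc t < a" by blast
    then have "occurrence_at (p @ w @ q) a i (length p + t) \<and> Suc (length p + t) < length (p @ w @ q)
        \<and> (p @ w @ q) ! Suc (length p + t) < a"
      using assms by (simp add: occurrence_at_append nth_append)
    then show ?L by blast
  qed
  then show ?thesis
    by (simp add: type_descent_def False)
qed

text \<open>What stands before, respectively after, one block of \<open>join m us\<close> (see
  \<open>join_split\<close>); when nonempty, it ends, respectively begins, with
  \<open>m\<close>.\<close>

definition join_left :: "nat \<Rightarrow> nat list list \<Rightarrow> nat list" where
  "join_left m us = concat (map (\<lambda>u. u @ [m]) us)"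
definition join_right :: "nat \<Rightarrow> nat list list \<Rightarrow> nat list" where
  "join_right m us = concat (map (\<lambda>u. m # u) us)"

lemma join_eq_join_right: "join m (u # us) = u @ join_right m us"
  by (induction us arbitrary: u) (auto simp: join_right_def)

lemma join_split:
  "i < length us \<Longrightarrow> join m us = join_left m (take i us) @ us ! i @ join_right m (drop (Suc i) us)"
proof (induction us arbitrary: i)
  case (Cons u us)
  show ?case
  proof (cases i)
    case 0
    then show ?thesis by (simp add: join_left_def join_eq_join_right)
  next
    case (Suc l)
    then have "us \<noteq> []" "l < length us" using Cons.prems by auto
    then show ?thesis
      using Cons.IH[of l] by (simp add: join_Cons Suc join_left_def)
  qed
qed simp

lemma last_join_left: "join_left m us = [] \<or> last (join_left m us) = m"
  by (induction us rule: rev_induct) (auto simp: join_left_def)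

lemma hd_join_right: "join_right m us = [] \<or> hd (join_right m us) = m"
  by (cases us) (auto simp: join_right_def)

lemma join_left_eq_Nil: "join_left m us = [] \<longleftrightarrow> us = []"
  by (cases us) (auto simp: join_left_def)

lemma set_join_left: "set (join_left m us) = (\<Union>u\<in>set us. set u) \<union> (if us = [] then {} else {m})"
  by (induction us) (auto simp: join_left_def)

lemma set_join_right: "set (join_right m us) = (\<Union>u\<in>set us. set u) \<union> (if us = [] then {} else {m})"
  by (induction us) (auto simp: join_right_def)

lemma count_join_left: "\<forall>u\<in>set us. m \<notin> set u \<Longrightarrow> count_list (join_left m us) m = length us"
  by (induction us) (auto simp: join_left_def)

lemma type_descent_join_block:
  assumes d: "disjoint_words us" and m: "\<forall>u\<in>set us. \<forall>a\<in>set u. a < m" and j: "j < length us" and a: "a \<in> set (us ! j)"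
  shows "type_descent (join m us) i a \<longleftrightarrow> type_descent (us ! j) i a"
proof -
  have am: "a < m"
    using m j a nth_mem by blast
  have other: "a \<notin> set (us ! l)" if "l < length us" "l \<noteq> j" for l
    using disjoint_words_nth[OF d that(1) j that(2)] a by auto
  have "a \<notin> set u" if "u \<in> set (take j us)" for u
  proof -
    obtain l where "l < length (take j us)" "take j us ! l = u"
      using \<open>u \<in> _\<close> by (meson in_set_conv_nth)
    then have "l < j" "u = us ! l" by auto
    then show ?thesis using other[of l] j by auto
  qed
  then have 1: "a \<notin> set (join_left m (take j us))"
    using am by (auto simp: set_join_left)
  have "a \<notin> set u" if "u \<in> set (drop (Suc j) us)" for u
  proof -
    obtain l where "l < length (drop (Suc j) us)" "drop (Suc j) us ! l = u"
      using \<open>u \<in> _\<close> by (meson in_set_conv_nth)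
    then have "Suc j + l < length us" "u = us ! (Suc j + l)" by auto
    then show ?thesis using other[of "Suc j + l"] by auto
  qed
  then have 2: "a \<notin> set (join_right m (drop (Suc j) us))"
    using am by (auto simp: set_join_right)
  show ?thesis
    unfolding join_split[OF j]
    using last_join_left[of m "take j us"] hd_join_right[of m "drop (Suc j) us"] am
    by (intro type_descent_factor 1 2) auto
qed

text \<open>With blocks numbered from 0, occurrence \<open>i \<ge> 1\<close> of \<open>m\<close> is
  followed by block \<open>i\<close>, and the first occurrence follows block 0. So a type
  \<open>i\<close> descent of the root is an edge to a nonempty child of type \<open>i\<close>. Two
  blocks guarantee that \<open>m\<close> occurs.\<close>

lemma type_descent_join_separator:
  assumes m: "\<forall>u\<in>set us. \<forall>a\<in>set u. a < m" and i: "i < length us" and two: "length us \<ge> 2"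
  shows "type_descent (join m us) i m \<longleftrightarrow> us ! i \<noteq> []"
proof -
  let ?w = "join m us"
  have notin: "m \<notin> set u" if "u \<in> set us" for u
    using m that by auto
  show ?thesis
  proof (cases "i = 0")
    case True
    obtain u v us' where us: "us = u # v # us'"
      using two by (cases us; cases "tl us") auto
    have occ: "occurrence_at ?w m 1 (length u)"
      using notin by (auto simp: occurrence_at_def us)
    have "(\<exists>p. occurrence_at ?w m 1 (Suc p) \<and> ?w ! p < m) \<longleftrightarrow> u \<noteq> []"
    proof
      assume "\<exists>p. occurrence_at ?w m 1 (Suc p) \<and> ?w ! p < m"
      then show "u \<noteq> []"
        using occurrence_at_unique[OF occ] by fastforce
    next
      assume "u \<noteq> []"
      then obtain p where p: "length u = Suc p"
        by (cases u) auto
      then have "?w ! p = u ! p" "u ! p \<in> set u"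
        by (auto simp: us nth_append)
      then have "?w ! p < m" using m us by auto
      then show "\<exists>p. occurrence_at ?w m 1 (Suc p) \<and> ?w ! p < m"
        using occ p by auto
    qed
    then show ?thesis
      by (simp add: type_descent_def True us)
  next
    case False
    let ?l = "join_left m (take i us)" and ?r = "join_right m (drop (Suc i) us)"
    have l: "?l \<noteq> []" "last ?l = m"
      using last_join_left[of m "take i us"] False i by (auto simp: join_left_eq_Nil)
    then obtain l' where l': "?l = l' @ [m]"
      by (metis append_butlast_last_id)
    have w: "?w = l' @ m # us ! i @ ?r"
      using join_split[OF i, of m] l' by simp
    \<comment> \<open>The last of these \<open>i\<close> copies is the final letter of
      \<open>?l\<close>, so occurrence \<open>i\<close> sits at position
      \<open>length l'\<close>.\<close>
    have "count_list ?l m = i"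
      using notin i by (subst count_join_left) (auto dest: in_set_takeD)
    then have occ: "occurrence_at ?w m i (length l')"
      using l' by (auto simp: occurrence_at_def w)
    have "(\<exists>p. occurrence_at ?w m i p \<and> Suc p < length ?w \<and> ?w ! Suc p < m) \<longleftrightarrow>
        Suc (length l') < length ?w \<and> ?w ! Suc (length l') < m"
      using occ occurrence_at_unique[OF occ] by blast
    also have "\<dots> \<longleftrightarrow> us ! i \<noteq> []"
    proof (cases "us ! i")
      case Nil
      then show ?thesis
        using hd_join_right[of m "drop (Suc i) us"] by (cases ?r) (auto simp: w nth_append)
    next
      case (Cons c cs)
      then have "c < m" using m i nth_mem[OF i] by (metis list.set_intros(1))
      then show ?thesis by (simp add: w nth_append Cons)
    qed
    finally show ?thesis
      using False by (simp add: type_descent_def)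
  qed
qed

text \<open>The descents are those of the root, at most one per type, and those inside the blocks,
  whose letters are disjoint.\<close>

lemma card_type_descent_join:
  assumes d: "disjoint_words us" and m: "\<forall>u\<in>set us. \<forall>a\<in>set u. a < m" and i: "i < length us" and two: "length us \<ge> 2"
  shows "card {a. type_descent (join m us) i a} =
    (if us ! i = [] then 0 else 1) + (\<Sum>u\<leftarrow>us. card {a. type_descent u i a})"
proof -
  let ?D = "\<lambda>w. {a. type_descent w i a}"
  have fin: "finite (?D w)" for w
    by (rule finite_subset[of _ "set w"]) (auto dest: type_descent_in_set)
  let ?M = "if us ! i = [] then {} else {m}"
  have "?D (join m us) = ?M \<union> (\<Union>j<length us. ?D (us ! j))"
  proof (intro set_eqI)
    fix a
    consider "a = m" | j where "j < length us" "a \<in> set (us ! j)"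
      | "a \<noteq> m" "\<forall>u\<in>set us. a \<notin> set u"
      by (metis in_set_conv_nth)
    then show "a \<in> ?D (join m us) \<longleftrightarrow> a \<in> ?M \<union> (\<Union>j<length us. ?D (us ! j))"
    proof cases
      case 1
      have "m \<notin> ?D (us ! j)" if "j < length us" for j
        using m nth_mem[OF that] type_descent_in_set by blast
      then show ?thesis
        using type_descent_join_separator[OF m i two] 1 by auto
    next
      case 2
      have "a \<notin> ?D (us ! l)" if "l < length us" "l \<noteq> j" for l
        using disjoint_words_nth[OF d that(1) 2(1) that(2)] 2(2) type_descent_in_set by blast
      moreover have "a \<noteq> m"
        using m 2 nth_mem by blast
      ultimately show ?thesis
        using type_descent_join_block[OF d m 2] 2(1) by auto
    next
      case 3
      then have "a \<notin> set (join m us)"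
        by (simp add: set_join)
      then have "a \<notin> ?D (join m us)"
        using type_descent_in_set by blast
      moreover have "a \<notin> ?D (us ! j)" if "j < length us" for j
        using 3 nth_mem[OF that] type_descent_in_set by blast
      ultimately show ?thesis
        using 3 by auto
    qed
  qed
  moreover have "card (?M \<union> (\<Union>j<length us. ?D (us ! j))) = card ?M + card (\<Union>j<length us. ?D (us ! j))"
  proof (rule card_Un_disjoint)
    show "?M \<inter> (\<Union>j<length us. ?D (us ! j)) = {}"
    proof -
      have "m \<notin> ?D (us ! j)" if "j < length us" for j
        using m nth_mem[OF that] type_descent_in_set by blast
      then show ?thesis by auto
    qed
  qed (auto simp: fin)
  moreover have "card (\<Union>j<length us. ?D (us ! j)) = (\<Sum>j<length us. card (?D (us ! j)))"
  proof (rule card_UN_disjoint)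
    show "\<forall>j\<in>{..<length us}. \<forall>l\<in>{..<length us}. j \<noteq> l \<longrightarrow> ?D (us ! j) \<inter> ?D (us ! l) = {}"
      using disjoint_words_nth[OF d] type_descent_in_set by blast
  qed (auto simp: fin)
  moreover have "(\<Sum>j<length us. card (?D (us ! j))) = (\<Sum>u\<leftarrow>us. card (?D u))"
    by (simp add: sum_list_sum_nth atLeast0LessThan)
  ultimately show ?thesis
    by auto
qed

section \<open>Recursion for weighted forests\<close>

text \<open>The offset \<open>a\<close> allows the upper part of a split word to be treated like the
  lower one.\<close>

definition sortable :: "nat \<Rightarrow> nat \<Rightarrow> nat list \<Rightarrow> bool" where
  "sortable a n t \<longleftrightarrow> distinct t \<and> stack_sort t = [Suc a..<Suc (a + n)]"

lemma sortable_set: "sortable a n t \<Longrightarrow> set t = {Suc a..<Suc (a + n)}"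
  unfolding sortable_def by (metis set_stack_sort set_upt)

lemma sortable_0: "sortable a 0 t \<longleftrightarrow> t = []"
  by (auto simp: sortable_def)

lemma sortable_length_unique: "sortable a m t \<Longrightarrow> sortable a m' t \<Longrightarrow> m = m'"
  unfolding sortable_def by (metis add_diff_cancel_left' diff_Suc_Suc length_upt)

text \<open>As \<open>S(pMq) = S(p)S(q)M\<close>, sorted output means that \<open>S(p)\<close> and
  \<open>S(q)\<close> are consecutive pieces of the interval, so every letter of \<open>p\<close> is
  below every letter of \<open>q\<close>. This is where avoidance of 231 enters.\<close>

lemma sortable_Suc:
  assumes "sortable a (Suc n) t"
  shows "\<exists>m p q. m \<le> n \<and> t = p @ Suc (a + n) # q \<and> sortable a m p \<and> sortable (a + m) (n - m) q"
proof -
  let ?M = "Suc (a + n)"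
  have t: "distinct t" "stack_sort t = [Suc a..<?M] @ [?M]" and set: "set t = {Suc a..<Suc ?M}"
    using assms sortable_set[OF assms] by (auto simp: sortable_def)
  have "?M \<in> set t" using set by simp
  then obtain p q where pq: "t = p @ ?M # q"
    by (meson split_list)
  have "x < ?M" if "x \<in> set p \<union> set q" for x
  proof -
    have "x \<le> ?M" using that set pq by (metis Un_iff atLeastLessThan_iff less_Suc_eq_le list.set_intros(2) set_append)
    moreover have "x \<noteq> ?M" using that t(1) pq by auto
    ultimately show ?thesis by simp
  qed
  then have "stack_sort t = stack_sort p @ stack_sort q @ [?M]"
    unfolding pq by (intro stack_sort_distinct) blast
  then have s: "[Suc a..<?M] = stack_sort p @ stack_sort q"
    using t(2) by simp
  define m where "m = length (stack_sort p)"
  have m: "m \<le> n"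
    using arg_cong[OF s, of length] by (simp add: m_def del: upt_Suc)
  have "stack_sort p = take m [Suc a..<?M]" "stack_sort q = drop m [Suc a..<?M]"
    unfolding s m_def by auto
  then have "sortable a m p" "sortable (a + m) (n - m) q"
    using m t(1) by (auto simp: sortable_def pq take_upt simp del: upt_Suc)
  then show ?thesis using m pq by blast
qed

lemma sortable_append:
  assumes "m \<le> n" "sortable a m p" "sortable (a + m) (n - m) q"
  shows "sortable a (Suc n) (p @ Suc (a + n) # q)"
proof -
  have "stack_sort (p @ Suc (a + n) # q) = stack_sort p @ stack_sort q @ [Suc (a + n)]"
    using sortable_set[OF assms(2)] sortable_set[OF assms(3)] assms(1)
    by (intro stack_sort_distinct) auto
  also have "\<dots> = [Suc a..<Suc (a + Suc n)]"
  proof -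
    have "[Suc a..<Suc (a + n)] = [Suc a..<Suc (a + m)] @ [Suc (a + m)..<Suc (a + n)]"
      using assms(1) upt_add_eq_append[of "Suc a" "Suc (a + m)" "n - m"] by simp
    then show ?thesis
      using assms by (simp add: sortable_def)
  qed
  finally show ?thesis
    using assms sortable_set[OF assms(2)] sortable_set[OF assms(3)] by (auto simp: sortable_def)
qed

text \<open>The concatenation is the postorder word of the forest. For a single tree
  \<open>w\<close>, sortability makes \<open>S(S(w))\<close> increasing.\<close>

definition forest :: "nat \<Rightarrow> nat \<Rightarrow> nat \<Rightarrow> nat list list \<Rightarrow> bool" where
  "forest r a n ws \<longleftrightarrow> (\<forall>w\<in>set ws. w \<noteq> [] \<and> multiperm r w) \<and> sortable a n (concat (map stack_sort ws))"

lemma forest_set: "forest r a n ws \<Longrightarrow> (\<Union>w\<in>set ws. set w) = {Suc a..<Suc (a + n)}"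
  unfolding forest_def using sortable_set[of a n "concat (map stack_sort ws)"] by simp

lemma forest_0: "forest r a 0 ws \<longleftrightarrow> ws = []"
  by (cases ws) (auto simp: forest_def sortable_0)

text \<open>Every letter occurs \<open>r\<close> times in its word, which bounds the word lengths by
  \<open>r * n\<close>.\<close>

lemma forest_finite: "finite {ws. forest r a n ws \<and> length ws = l}"
proof -
  let ?V = "{w. set w \<subseteq> {Suc a..<Suc (a + n)} \<and> length w \<le> r * n}"
  have "w \<in> ?V" if "forest r a n ws" "w \<in> set ws" for w ws
  proof -
    have s: "set w \<subseteq> {Suc a..<Suc (a + n)}"
      using forest_set[OF that(1)] that(2) by auto
    have "length w = (\<Sum>b\<in>set w. count_list w b)"
      by (simp add: sum_count_set)
    also have "\<dots> = card (set w) * r"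
      using that by (simp add: forest_def multiperm_iff)
    also have "card (set w) \<le> n"
      using card_mono[OF _ s] by simp
    finally show ?thesis
      using s by (simp add: mult.commute)
  qed
  then have "{ws. forest r a n ws \<and> length ws = l} \<subseteq> {ws. set ws \<subseteq> ?V \<and> length ws = l}"
    by blast
  moreover have "finite {ws. set ws \<subseteq> ?V \<and> length ws = l}"
    by (intro finite_lists_length_eq finite_lists_length_le) simp
  ultimately show ?thesis
    by (rule finite_subset)
qed

abbreviation nonempty :: "nat list list \<Rightarrow> nat list list" where
  "nonempty \<equiv> filter (\<lambda>u. u \<noteq> [])"

lemma concat_stack_sort_nonempty: "concat (map stack_sort (nonempty us)) = concat (map stack_sort us)"
  by (induction us) (auto simp: stack_sort_Nil)

text \<open>The largest letter is the root of some tree \<open>w\<close> and closes the postorder of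
  \<open>w\<close>. Before it come the trees preceding \<open>w\<close> and the nonempty subtrees of
  \<open>w\<close>; after it come the later trees. \<open>sortable_Suc\<close> cuts the postorder at
  the same place.\<close>

lemma forest_Suc_decompose:
  assumes f: "forest r a (Suc n) ws" and r: "r \<ge> 1"
  shows "\<exists>m pre us post. m \<le> n \<and> length us = Suc r \<and> ws = pre @ join (Suc (a + n)) us # post \<and>
    forest r a m (pre @ nonempty us) \<and> forest r (a + m) (n - m) post"
proof -
  let ?M = "Suc (a + n)"
  let ?t = "concat (map stack_sort ws)"
  have w: "\<forall>w\<in>set ws. w \<noteq> [] \<and> multiperm r w" and t: "sortable a (Suc n) ?t"
    using f by (auto simp: forest_def)
  obtain m p q where mpq: "m \<le> n" "?t = p @ ?M # q" "sortable a m p" "sortable (a + m) (n - m) q"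
    using sortable_Suc[OF t] by blast
  have le: "\<forall>w\<in>set ws. \<forall>b\<in>set w. b \<le> ?M"
  proof (intro ballI)
    fix w b assume "w \<in> set ws" "b \<in> set w"
    then have "b \<in> (\<Union>w\<in>set ws. set w)" by blast
    then show "b \<le> ?M"
      unfolding forest_set[OF f] by simp
  qed
  have "?M \<in> (\<Union>w\<in>set ws. set w)"
    unfolding forest_set[OF f] by simp
  then obtain w where w': "w \<in> set ws" "?M \<in> set w" by blast
  then obtain pre post where ws: "ws = pre @ w # post"
    by (meson split_list)
  have max: "Max (set w) = ?M"
    using w' le by (intro Max_eqI) auto
  define us where "us = blocks ?M w"
  have mw: "multiperm r w" "w \<noteq> []" using w w' by auto
  note us = multiperm_blocks[OF mw r, unfolded max, folded us_def]
  have "stack_sort w = concat (map stack_sort us) @ [?M]"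
    using mw(2) max by (subst stack_sort.simps) (simp add: us_def)
  then have t': "?t = concat (map stack_sort (pre @ us)) @ ?M # concat (map stack_sort post)"
    by (simp add: ws)
  \<comment> \<open>The letters being distinct, the cut at \<open>?M\<close> found by
    \<open>sortable_Suc\<close> and the one read off from the trees coincide.\<close>
  have "distinct (p @ ?M # q)"
    using t mpq(2) by (simp add: sortable_def)
  then have "?M \<notin> set p" "?M \<notin> set q" by auto
  moreover have "p @ ?M # q = concat (map stack_sort (pre @ us)) @ ?M # concat (map stack_sort post)"
    using mpq(2) t' by simp
  ultimately have "p = concat (map stack_sort (pre @ us))" "q = concat (map stack_sort post)"
    using append_Cons_eq_iff by metis+
  then have "forest r a m (pre @ nonempty us)" "forest r (a + m) (n - m) post"
    using w us(4) mpq by (auto simp: forest_def ws concat_stack_sort_nonempty)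
  moreover have "w = join ?M us"
    by (simp add: us_def join_blocks)
  ultimately show ?thesis
    using mpq(1) us(1) ws by blast
qed

text \<open>Inverse of \<open>forest_Suc_decompose\<close>. The last two conclusions serve to
  compute the weight of the new tree and to recover its blocks.\<close>

lemma forest_Suc_compose:
  assumes r: "r \<ge> 1" and m: "m \<le> n" and us: "length us = Suc r"
    and f: "forest r a m (pre @ nonempty us)" and g: "forest r (a + m) (n - m) post"
  shows "forest r a (Suc n) (pre @ join (Suc (a + n)) us # post)"
    and "disjoint_words us" and "\<forall>u\<in>set us. \<forall>b\<in>set u. b < Suc (a + n)"
proof -
  let ?M = "Suc (a + n)"
  let ?w = "join ?M us"
  show less: "\<forall>u\<in>set us. \<forall>b\<in>set u. b < ?M"
  proof (intro ballI)
    fix u b assume "u \<in> set us" "b \<in> set u"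
    then have "b \<in> (\<Union>w\<in>set (pre @ nonempty us). set w)" by auto
    then show "b < ?M"
      unfolding forest_set[OF f] using m by simp
  qed
  have "distinct (concat (map stack_sort (pre @ us)))"
    using f by (simp add: forest_def sortable_def concat_stack_sort_nonempty)
  then have "distinct (concat (map stack_sort us))"
    by simp
  then show disj: "disjoint_words us"
    by (simp add: disjoint_words_stack_sort)
  have "multiperm r u" if "u \<in> set us" for u
  proof (cases "u = []")
    case False
    then have "u \<in> set (pre @ nonempty us)" using that by simp
    then show ?thesis using f unfolding forest_def by blast
  qed (simp add: r_permutation_def)
  then have mw: "multiperm r ?w"
    using multiperm_join_iff[OF us r less disj] by simp
  have M: "?M \<in> set ?w"
    using us r by (simp add: set_join)
  then have "?w \<noteq> []" by auto
  have max: "Max (set ?w) = ?M"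
    using M less by (intro Max_eqI) (auto simp: set_join less_imp_le split: if_splits)
  have "blocks ?M ?w = us"
    using us less by (intro blocks_join) auto
  then have "stack_sort ?w = concat (map stack_sort us) @ [?M]"
    using \<open>?w \<noteq> []\<close> by (subst stack_sort.simps) (simp add: max)
  then have eq: "concat (map stack_sort (pre @ ?w # post))
      = concat (map stack_sort (pre @ nonempty us)) @ ?M # concat (map stack_sort post)"
    by (simp add: concat_stack_sort_nonempty)
  have "sortable a (Suc n) (concat (map stack_sort (pre @ ?w # post)))"
    unfolding eq using f[unfolded forest_def, THEN conjunct2] g[unfolded forest_def, THEN conjunct2]
    by (rule sortable_append[OF m])
  moreover have "v \<noteq> [] \<and> multiperm r v" if v: "v \<in> set (pre @ ?w # post)" for v
  proof -
    have "v \<in> set pre \<or> v = ?w \<or> v \<in> set post"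
      using v by (simp only: set_append list.set Un_iff insert_iff)
    then consider "v \<in> set pre" | "v = ?w" | "v \<in> set post" by blast
    then show ?thesis
    proof cases
      case 1
      then have "v \<in> set (pre @ nonempty us)" by simp
      then show ?thesis
        by (rule f[unfolded forest_def, THEN conjunct1, THEN bspec])
    next
      case 2
      then show ?thesis
        using mw \<open>?w \<noteq> []\<close> by (simp only:) simp
    next
      case 3
      then show ?thesis
        by (rule g[unfolded forest_def, THEN conjunct1, THEN bspec])
    qed
  qed
  ultimately show "forest r a (Suc n) (pre @ ?w # post)"
    unfolding forest_def by (intro conjI[OF ballI])
qed

section \<open>Weights, and the distribution of subtrees over child types\<close>

definition word_weight :: "nat \<Rightarrow> (nat \<Rightarrow> real) \<Rightarrow> nat list \<Rightarrow> real" where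
  "word_weight r x w = (\<Prod>i\<le>r. x i ^ card {a. type_descent w i a})"

definition forest_weight :: "nat \<Rightarrow> (nat \<Rightarrow> real) \<Rightarrow> nat list list \<Rightarrow> real" where
  "forest_weight r x ws = (\<Prod>w\<leftarrow>ws. word_weight r x w)"

text \<open>By \<open>type_descent_join_separator\<close>, the weight of the edges leaving the
  root.\<close>

definition block_weight :: "(nat \<Rightarrow> real) \<Rightarrow> nat list list \<Rightarrow> real" where
  "block_weight x us = (\<Prod>i<length us. if us ! i = [] then 1 else x i)"

text \<open>Elementary symmetric polynomial of degree \<open>j\<close> in \<open>x 0\<close>, ...,
  \<open>x (k - 1)\<close>; as a coefficient it vanishes for \<open>j > k\<close>.\<close>

definition esym :: "nat \<Rightarrow> (nat \<Rightarrow> real) \<Rightarrow> nat \<Rightarrow> real" where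
  "esym k x j = coeff (\<Prod>i<k. [:1, x i:]) j"

lemma esym_Suc: "esym (Suc k) x j = esym k x j + (if j = 0 then 0 else x k * esym k x (j - 1))"
  by (cases j) (simp_all add: esym_def mult.commute[of _ "[:1, x k:]"])

lemma word_weight_Nil [simp]: "word_weight r x [] = 1"
proof -
  have "{a. type_descent [] i a} = {}" for i by simp
  then show ?thesis
    unfolding word_weight_def by (simp only: card.empty power_0 prod.neutral_const)
qed

lemma forest_weight_nonempty: "forest_weight r x (nonempty us) = forest_weight r x us"
  by (induction us) (auto simp: forest_weight_def)

lemma forest_weight_append: "forest_weight r x (us @ vs) = forest_weight r x us * forest_weight r x vs"
  by (simp add: forest_weight_def)

lemma word_weight_join:
  assumes "length us = Suc r" "r \<ge> 1" "disjoint_words us" "\<forall>u\<in>set us. \<forall>b\<in>set u. b < m"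
  shows "word_weight r x (join m us) = block_weight x us * forest_weight r x us"
proof -
  have "x i ^ card {a. type_descent (join m us) i a}
      = (if us ! i = [] then 1 else x i) * (\<Prod>u\<leftarrow>us. x i ^ card {a. type_descent u i a})" if "i \<le> r" for i
  proof -
    have *: "x i ^ (\<Sum>u\<leftarrow>us. card {a. type_descent u i a}) = (\<Prod>u\<leftarrow>us. x i ^ card {a. type_descent u i a})" for us
      by (induction us) (auto simp: power_add)
    show ?thesis
      using assms that by (subst card_type_descent_join) (auto simp: power_add *)
  qed
  then have "word_weight r x (join m us) = (\<Prod>i\<le>r. if us ! i = [] then 1 else x i)
      * (\<Prod>i\<le>r. \<Prod>u\<leftarrow>us. x i ^ card {a. type_descent u i a})"
    by (simp add: word_weight_def prod.distrib)
  moreover have "(\<Prod>i\<le>r. \<Prod>u\<leftarrow>us. x i ^ card {a. type_descent u i a}) = forest_weight r x us"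
    by (induction us) (auto simp: forest_weight_def word_weight_def prod.distrib)
  ultimately show ?thesis
    using assms(1) by (simp add: block_weight_def lessThan_Suc_atMost)
qed

text \<open>The ways of attaching the trees \<open>vs\<close>, in their order, to \<open>k\<close>
  typed child positions.\<close>

definition fills :: "nat \<Rightarrow> nat list list \<Rightarrow> nat list list set" where
  "fills k vs = {us. length us = k \<and> nonempty us = vs}"

lemma fills_Suc:
  assumes "[] \<notin> set vs"
  shows "fills (Suc k) vs = (\<lambda>us. us @ [[]]) ` fills k vs \<union>
    (if vs = [] then {} else (\<lambda>us. us @ [last vs]) ` fills k (butlast vs))"
proof (intro set_eqI iffI)
  fix us assume us: "us \<in> fills (Suc k) vs"
  then obtain us' u where u: "us = us' @ [u]"
    by (cases us rule: rev_cases) (auto simp: fills_def)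
  show "us \<in> (\<lambda>us. us @ [[]]) ` fills k vs \<union> (if vs = [] then {} else (\<lambda>us. us @ [last vs]) ` fills k (butlast vs))"
    using us by (cases "u = []") (auto simp: fills_def u)
next
  fix us assume us: "us \<in> (\<lambda>us. us @ [[]]) ` fills k vs \<union> (if vs = [] then {} else (\<lambda>us. us @ [last vs]) ` fills k (butlast vs))"
  moreover have "last vs \<noteq> []" if "vs \<noteq> []"
    using assms that last_in_set by fastforce
  ultimately show "us \<in> fills (Suc k) vs"
    by (auto simp: fills_def split: if_splits)
qed

lemma fills_finite: "[] \<notin> set vs \<Longrightarrow> finite (fills k vs)"
proof (induction k arbitrary: vs)
  case (Suc k)
  then show ?case
    by (auto simp: fills_Suc dest: in_set_butlastD)
qed (simp add: fills_def)

text \<open>Each choice of \<open>length vs\<close> positions out of \<open>k\<close> contributes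
  the product of their \<open>x i\<close>. Whether the last position stays empty distinguishes the
  two terms of \<open>esym_Suc\<close>.\<close>

lemma sum_fills:
  "[] \<notin> set vs \<Longrightarrow> (\<Sum>us\<in>fills k vs. block_weight x us) = esym k x (length vs)"
proof (induction k arbitrary: vs)
  case 0
  have "fills 0 vs = (if vs = [] then {[]} else {})"
    by (auto simp: fills_def)
  then show ?case
    by (auto simp: esym_def block_weight_def)
next
  case (Suc k)
  have bw: "block_weight x (us @ [u]) = block_weight x us * (if u = [] then 1 else x (length us))" for us u
    by (simp add: block_weight_def nth_append)
  have inj: "inj_on (\<lambda>us. us @ [u]) A" for u :: "nat list" and A
    by (simp add: inj_on_def)
  have len: "length us = k" if "us \<in> fills k vs" for us vs
    using that by (simp add: fills_def)
  have 1: "(\<Sum>us\<in>(\<lambda>us. us @ [[]]) ` fills k vs. block_weight x us) = esym k x (length vs)"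
    using Suc by (simp add: sum.reindex[OF inj] bw)
  show ?case
  proof (cases "vs = []")
    case True
    then show ?thesis using 1 Suc.prems by (simp add: fills_Suc esym_Suc)
  next
    case False
    have l: "last vs \<noteq> []"
      using Suc.prems False last_in_set by fastforce
    have b: "[] \<notin> set (butlast vs)"
      using Suc.prems by (auto dest: in_set_butlastD)
    have "(\<Sum>us\<in>(\<lambda>us. us @ [last vs]) ` fills k (butlast vs). block_weight x us)
        = (\<Sum>us\<in>fills k (butlast vs). block_weight x us * x k)"
      using l by (simp add: sum.reindex[OF inj] bw len cong: sum.cong)
    also have "\<dots> = x k * esym k x (length vs - 1)"
      using Suc.IH[OF b] by (simp add: sum_distrib_right[symmetric])
    finally have 2: "(\<Sum>us\<in>(\<lambda>us. us @ [last vs]) ` fills k (butlast vs). block_weight x us) = \<dots>" .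
    have "(\<Sum>us\<in>fills (Suc k) vs. block_weight x us) =
       (\<Sum>us\<in>(\<lambda>us. us @ [[]]) ` fills k vs. block_weight x us) +
       (\<Sum>us\<in>(\<lambda>us. us @ [last vs]) ` fills k (butlast vs). block_weight x us)"
      unfolding fills_Suc[OF Suc.prems] using False l Suc.prems b
      by (simp, intro sum.union_disjoint) (auto simp: fills_finite)
    then show ?thesis
      using 1 2 False by (simp add: esym_Suc)
  qed
qed

section \<open>Recursion by removing the largest letter\<close>

definition forests :: "nat \<Rightarrow> nat \<Rightarrow> nat \<Rightarrow> nat \<Rightarrow> nat list list set" where
  "forests r a n l = {ws. forest r a n ws \<and> length ws = l}"

definition total_weight :: "nat \<Rightarrow> (nat \<Rightarrow> real) \<Rightarrow> nat \<Rightarrow> nat \<Rightarrow> nat \<Rightarrow> real" where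
  "total_weight r x a n l = (\<Sum>ws\<in>forests r a n l. forest_weight r x ws)"

lemma finite_forests: "finite (forests r a n l)"
  unfolding forests_def by (rule forest_finite)

lemma total_weight_0: "total_weight r x a 0 l = (if l = 0 then 1 else 0)"
proof -
  have "forests r a 0 l = (if l = 0 then {[]} else {})"
    by (auto simp: forests_def forest_0)
  then show ?thesis
    by (simp add: total_weight_def forest_weight_def)
qed

text \<open>Both cuts are at the first element satisfying \<open>P\<close>. It is applied with
  \<open>P\<close> saying that a tree contains the largest letter.\<close>

lemma append_Cons_unique:
  assumes "xs @ y # zs = xs' @ y' # zs'" "P y" "P y'" "\<forall>x\<in>set xs. \<not> P x" "\<forall>x\<in>set xs'. \<not> P x"
  shows "xs = xs' \<and> y = y' \<and> zs = zs'"
proof -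
  have t: "takeWhile (\<lambda>x. \<not> P x) (xs @ y # zs) = xs" if "P y" "\<forall>x\<in>set xs. \<not> P x" for xs y zs
    using that by (induction xs) auto
  have "xs = xs'"
    using t[of y xs zs] t[of y' xs' zs'] assms by simp
  then show ?thesis using assms(1) by simp
qed

text \<open>Coefficient form of F = 1 + z u F H. Removing the root with the largest letter leaves a
  forest on \<open>m\<close> letters, namely the \<open>p\<close> trees before that root and its
  \<open>j\<close> subtrees, and a forest of \<open>l - 1 - p\<close> later trees on the other
  \<open>n - m\<close> letters.\<close>

lemma total_weight_Suc:
  assumes r: "r \<ge> 1"
  shows "total_weight r x a (Suc n) l =
    (\<Sum>m\<le>n. \<Sum>p<l. (\<Sum>j\<le>Suc r. esym (Suc r) x j * total_weight r x a m (p + j)) *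
      total_weight r x (a + m) (n - m) (l - 1 - p))"
proof -
  let ?M = "Suc (a + n)"
  \<comment> \<open>A tuple records both forests and a placement \<open>us\<close> of the last
    \<open>j\<close> trees of \<open>ws\<close> on the child positions of the new root;
    \<open>g\<close> inserts this root.\<close>
  define Z where "Z = (SIGMA m:{..n}. SIGMA p:{..<l}. SIGMA j:{..Suc r}. SIGMA ws:forests r a m (p + j).
     SIGMA us:fills (Suc r) (drop p ws). forests r (a + m) (n - m) (l - 1 - p))"
  define g where "g = (\<lambda>(m :: nat, p, j :: nat, ws, us, post). take p ws @ join ?M us # post)"
  have vs: "[] \<notin> set (drop p ws)" if "ws \<in> forests r a m k" for p ws m k
    using that by (auto simp: forests_def forest_def dest: in_set_dropD)
  have Z: "m \<le> n \<and> p < l \<and> length ws = p + j \<and> forest r a m ws \<and> length us = Suc r \<and> ws = take p ws @ nonempty us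
      \<and> forest r (a + m) (n - m) post \<and> length post = l - 1 - p"
    if "(m, p, j, ws, us, post) \<in> Z" for m p j ws us post
    using that by (auto simp: Z_def forests_def fills_def)
  have comp: "forest r a (Suc n) (take p ws @ join ?M us # post)" "disjoint_words us"
      "\<forall>u\<in>set us. \<forall>b\<in>set u. b < ?M"
    if "(m, p, j, ws, us, post) \<in> Z" for m p j ws us post
    using forest_Suc_compose[OF r, of m n us a "take p ws" post] Z[OF that] by metis+
  have "(\<Sum>m\<le>n. \<Sum>p<l. (\<Sum>j\<le>Suc r. esym (Suc r) x j * total_weight r x a m (p + j)) *
      total_weight r x (a + m) (n - m) (l - 1 - p))
    = (\<Sum>m\<le>n. \<Sum>p<l. \<Sum>j\<le>Suc r. \<Sum>ws\<in>forests r a m (p + j). \<Sum>us\<in>fills (Suc r) (drop p ws).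
       \<Sum>post\<in>forests r (a + m) (n - m) (l - 1 - p).
       block_weight x us * forest_weight r x ws * forest_weight r x post)"
  proof (intro sum.cong refl)
    fix m p
    have "esym (Suc r) x j * forest_weight r x ws = (\<Sum>us\<in>fills (Suc r) (drop p ws). block_weight x us * forest_weight r x ws)"
      if "ws \<in> forests r a m (p + j)" for ws j
    proof -
      have "length (drop p ws) = j" using that by (simp add: forests_def)
      then show ?thesis
        using sum_fills[OF vs[OF that, of p], where k = "Suc r" and x = x] by (simp add: sum_distrib_right[symmetric])
    qed
    then have "esym (Suc r) x j * total_weight r x a m (p + j) =
       (\<Sum>ws\<in>forests r a m (p + j). \<Sum>us\<in>fills (Suc r) (drop p ws). block_weight x us * forest_weight r x ws)" for j
      by (simp add: total_weight_def sum_distrib_left)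
    then show "(\<Sum>j\<le>Suc r. esym (Suc r) x j * total_weight r x a m (p + j)) * total_weight r x (a + m) (n - m) (l - 1 - p) =
      (\<Sum>j\<le>Suc r. \<Sum>ws\<in>forests r a m (p + j). \<Sum>us\<in>fills (Suc r) (drop p ws).
       \<Sum>post\<in>forests r (a + m) (n - m) (l - 1 - p).
       block_weight x us * forest_weight r x ws * forest_weight r x post)"
      by (simp only: sum_distrib_right) (simp only: total_weight_def sum_distrib_left)
  qed
  also have "\<dots> = (\<Sum>(m, p, j, ws, us, post)\<in>Z. block_weight x us * forest_weight r x ws * forest_weight r x post)"
    unfolding Z_def by (simp add: sum.Sigma finite_forests fills_finite vs del: sum.atMost_Suc)
  also have "\<dots> = (\<Sum>z\<in>Z. forest_weight r x (g z))"
  proof (rule sum.cong[OF refl])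
    fix z assume "z \<in> Z"
    then obtain m p j ws us post where z: "z = (m, p, j, ws, us, post)" "(m, p, j, ws, us, post) \<in> Z"
      by (metis prod_cases6)
    have "ws = take p ws @ nonempty us" using Z[OF z(2)] by blast
    then have "forest_weight r x ws = forest_weight r x (take p ws) * forest_weight r x us"
      using forest_weight_append[of r x "take p ws" "nonempty us"] by (simp add: forest_weight_nonempty)
    moreover have "forest_weight r x (g z) = forest_weight r x (take p ws) * (word_weight r x (join ?M us) * forest_weight r x post)"
      by (simp add: z g_def forest_weight_append) (simp add: forest_weight_def)
    moreover have "word_weight r x (join ?M us) = block_weight x us * forest_weight r x us"
      using Z[OF z(2)] comp[OF z(2)] r by (intro word_weight_join) auto
    ultimately show "(case z of (m, p, j, ws, us, post) \<Rightarrow> block_weight x us * forest_weight r x ws * forest_weight r x post)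
      = forest_weight r x (g z)"
      by (simp add: z)
  qed
  also have "\<dots> = (\<Sum>ws\<in>g ` Z. forest_weight r x ws)"
  proof (rule sum.reindex[symmetric, unfolded comp_def])
    show "inj_on g Z"
    proof (rule inj_onI)
      fix z z' assume zz: "z \<in> Z" "z' \<in> Z" "g z = g z'"
      obtain m p j ws us post where z: "z = (m, p, j, ws, us, post)" "(m, p, j, ws, us, post) \<in> Z"
        using zz(1) by (metis prod_cases6)
      obtain m' p' j' ws' us' post' where z': "z' = (m', p', j', ws', us', post')" "(m', p', j', ws', us', post') \<in> Z"
        using zz(2) by (metis prod_cases6)
      have notin: "\<forall>w\<in>set (take p ws). ?M \<notin> set w" if "(m, p, j, ws, us, post) \<in> Z" for m p j ws us post
      proof
        fix w assume "w \<in> set (take p ws)"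
        then have "set w \<subseteq> (\<Union>w\<in>set ws. set w)"
          using in_set_takeD by fastforce
        also have "\<dots> = {Suc a..<Suc (a + m)}"
          using Z[OF that] forest_set by blast
        finally show "?M \<notin> set w"
          using Z[OF that] by auto
      qed
      have M: "?M \<in> set (join ?M us)" if "(m, p, j, ws, us, post) \<in> Z" for m p j ws us post
        using Z[OF that] r by (simp add: set_join)
      have bl: "blocks ?M (join ?M us) = us" if "(m, p, j, ws, us, post) \<in> Z" for m p j ws us post
        using Z[OF that] comp(3)[OF that] by (intro blocks_join) auto
      have "take p ws @ join ?M us # post = take p' ws' @ join ?M us' # post'"
        using zz(3) by (simp add: g_def z(1) z'(1))
      then have eq: "take p ws = take p' ws' \<and> join ?M us = join ?M us' \<and> post = post'"
        by (rule append_Cons_unique[where P = "\<lambda>w. ?M \<in> set w"])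
          (use M[OF z(2)] M[OF z'(2)] notin[OF z(2)] notin[OF z'(2)] in auto)
      have f: "length ws = p + j" "forest r a m ws" "ws = take p ws @ nonempty us"
        using Z[OF z(2)] by blast+
      have f': "length ws' = p' + j'" "forest r a m' ws'" "ws' = take p' ws' @ nonempty us'"
        using Z[OF z'(2)] by blast+
      have us: "us = us'"
        using arg_cong[OF conjunct1[OF conjunct2[OF eq]], of "blocks ?M"] bl[OF z(2)] bl[OF z'(2)] by simp
      have ws: "ws = ws'"
        using f(3) f'(3) eq us by metis
      have p: "p = p'"
        using arg_cong[OF conjunct1[OF eq], of length] f(1) f'(1) by simp
      \<comment> \<open>The forest \<open>ws\<close> determines \<open>m\<close> as the length of
        its postorder word.\<close>
      have "m = m'"
        by (rule sortable_length_unique[OF f(2)[unfolded forest_def ws, THEN conjunct2]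
              f'(2)[unfolded forest_def, THEN conjunct2]])
      moreover have "j = j'"
        using f(1) f'(1) ws p by simp
      ultimately show "z = z'"
        unfolding z(1) z'(1) using eq us ws p by blast
    qed
  qed
  also have "g ` Z = forests r a (Suc n) l"
  proof (intro set_eqI iffI)
    fix ws assume "ws \<in> g ` Z"
    then obtain z where zZ: "z \<in> Z" "ws = g z" by blast
    obtain m p j ws' us post where z: "z = (m, p, j, ws', us, post)"
      by (cases z rule: prod_cases6)
    have zZ': "(m, p, j, ws', us, post) \<in> Z" using zZ(1) z by simp
    have wsz: "ws = take p ws' @ join ?M us # post" using zZ(2) z by (simp add: g_def)
    have "p < l" "length ws' = p + j" "length post = l - 1 - p"
      using Z[OF zZ'] by blast+
    then have "length ws = l"
      by (simp add: wsz)
    then show "ws \<in> forests r a (Suc n) l"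
      using comp(1)[OF zZ'] unfolding forests_def wsz by blast
  next
    fix ws assume ws: "ws \<in> forests r a (Suc n) l"
    then obtain m pre us post where d: "m \<le> n" "length us = Suc r" "ws = pre @ join ?M us # post"
      "forest r a m (pre @ nonempty us)" "forest r (a + m) (n - m) post"
      using forest_Suc_decompose[OF _ r] unfolding forests_def by blast
    have l: "length pre + 1 + length post = l"
      using ws d(3) by (simp add: forests_def)
    have "length (nonempty us) \<le> Suc r"
      using d(2) length_filter_le by metis
    then have "(m, length pre, length (nonempty us), pre @ nonempty us, us, post) \<in> Z"
      using d l by (auto simp: Z_def forests_def fills_def)
    moreover have "ws = g (m, length pre, length (nonempty us), pre @ nonempty us, us, post)"
      by (simp add: g_def d(3))
    ultimately show "ws \<in> g ` Z" by blast
  qed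
  finally show ?thesis
    by (simp add: total_weight_def)
qed

section \<open>Power series tools\<close>

unbundle fps_syntax

lemma fps_compose_times_nth:
  fixes f g h :: "'a::idom fps"
  assumes "g $ 0 = 0"
  shows "((f oo g) * h) $ n = (\<Sum>i=0..n. f $ i * (g ^ i * h) $ n)"
proof -
  have "((f oo g) * h) $ n = (\<Sum>j=0..n. (\<Sum>i=0..j. f $ i * (g ^ i) $ j) * h $ (n - j))"
    by (simp add: fps_mult_nth fps_compose_nth)
  also have "\<dots> = (\<Sum>j=0..n. (\<Sum>i=0..n. f $ i * (g ^ i) $ j) * h $ (n - j))"
  proof (rule sum.cong[OF refl])
    \<comment> \<open>Powers \<open>g ^ i\<close> with \<open>i > j\<close> have no coefficient in
      degree \<open>j\<close>; extending the range makes it independent of \<open>j\<close>, so that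
      the sums can be swapped.\<close>
    fix j assume "j \<in> {0..n}"
    then have "(\<Sum>i=0..j. f $ i * (g ^ i) $ j) = (\<Sum>i=0..n. f $ i * (g ^ i) $ j)"
      using startsby_zero_power_prefix[OF assms] by (intro sum.mono_neutral_left) (auto simp: not_le)
    then show "(\<Sum>i=0..j. f $ i * (g ^ i) $ j) * h $ (n - j) = (\<Sum>i=0..n. f $ i * (g ^ i) $ j) * h $ (n - j)"
      by simp
  qed
  also have "\<dots> = (\<Sum>i=0..n. f $ i * (g ^ i * h) $ n)"
    by (simp add: fps_mult_nth sum_distrib_left sum_distrib_right mult.assoc) (rule sum.swap)
  finally show ?thesis .
qed

text \<open>The solution is the compositional inverse of X/\<Phi>.\<close>

lemma fps_fixed_point_exists:
  fixes \<Phi> :: "'a::field fps"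
  assumes "\<Phi> $ 0 \<noteq> 0"
  shows "\<exists>s. s $ 0 = 0 \<and> s = fps_X * (\<Phi> oo s)"
proof -
  define g where "g = fps_X * inverse \<Phi>"
  have g: "g $ 0 = 0" "g $ 1 \<noteq> 0"
    using assms by (auto simp: g_def)
  define s where "s = fps_inv g"
  have s0: "s $ 0 = 0"
    by (simp add: s_def fps_inv_def)
  have "fps_X = g oo s"
    unfolding s_def using fps_inv_right[OF g] by simp
  also have "\<dots> = s * inverse (\<Phi> oo s)"
    using s0 assms by (simp add: g_def fps_compose_mult_distrib fps_inverse_compose)
  finally have "fps_X * (\<Phi> oo s) = s * (inverse (\<Phi> oo s) * (\<Phi> oo s))"
    by (simp add: mult.assoc)
  also have "\<dots> = s"
    using assms by (simp add: inverse_mult_eq_1)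
  finally show ?thesis
    using s0 by metis
qed

text \<open>With g = X/\<Phi> inverse to s, the identity s'(g) g' = 1 is multiplied by
  \<open>\<Phi> ^ n\<close>. When s'(g) is expanded in powers of g, only the term i = n - 1
  contributes to degree n - 1.\<close>

lemma fps_lagrange_inversion:
  fixes s \<Phi> :: "'a::field_char_0 fps"
  assumes "\<Phi> $ 0 \<noteq> 0" and s0: "s $ 0 = 0" and s: "s = fps_X * (\<Phi> oo s)" and "n > 0"
  shows "of_nat n * s $ n = (\<Phi> ^ n) $ (n - 1)"
proof -
  define \<Psi> where "\<Psi> = inverse \<Phi>"
  have \<Psi>: "\<Psi> * \<Phi> = 1"
    using assms by (simp add: \<Psi>_def inverse_mult_eq_1)
  then have \<Psi>pow: "\<Psi> ^ i * \<Phi> ^ i = 1" for i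
    by (simp flip: power_mult_distrib)
  define g where "g = fps_X * \<Psi>"
  have g: "g $ 0 = 0" "g $ 1 \<noteq> 0"
    using assms by (auto simp: g_def \<Psi>_def)
  have "g oo s = s * inverse (\<Phi> oo s)"
    using s0 assms by (simp add: g_def \<Psi>_def fps_compose_mult_distrib fps_inverse_compose)
  also have "\<dots> = fps_X * ((\<Phi> oo s) * inverse (\<Phi> oo s))"
    by (subst s) (simp add: mult.assoc)
  also have "\<dots> = fps_X"
    using assms by (simp add: inverse_mult_eq_1')
  finally have gs: "g oo s = fps_X" .
  \<comment> \<open>A right inverse is also a left inverse: \<open>g\<close> is cancelled on the
    left by composing with \<open>fps_inv g\<close>.\<close>
  have "(g oo s) oo g = g oo (s oo g)"
    using g s0 by (metis fps_compose_assoc)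
  then have "g oo (s oo g) = g oo fps_X"
    by (simp add: gs g)
  moreover have "(fps_inv g oo g) oo (s oo g) = fps_inv g oo (g oo (s oo g))"
    using g s0 by (intro fps_compose_assoc[symmetric]) auto
  ultimately have sg: "s oo g = fps_X"
    using fps_inv[OF g] g by (simp add: s0)
  have "fps_deriv (s oo g) = (fps_deriv s oo g) * fps_deriv g"
    using g by (simp add: fps_compose_deriv)
  then have "(fps_deriv s oo g) * fps_deriv g = 1"
    by (simp add: sg)
  then have "(\<Phi> ^ n) $ (n - 1) = ((fps_deriv s oo g) * (fps_deriv g * \<Phi> ^ n)) $ (n - 1)"
    by (metis mult.assoc mult_1)
  also have "\<dots> = (\<Sum>i=0..n-1. fps_deriv s $ i * (g ^ i * (fps_deriv g * \<Phi> ^ n)) $ (n - 1))"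
    by (rule fps_compose_times_nth) (rule g)
  also have "\<dots> = (\<Sum>i=0..n-1. if i = n - 1 then fps_deriv s $ i else 0)"
  proof (intro sum.cong refl)
    fix i assume "i \<in> {0..n-1}"
    define j where "j = n - 1 - i"
    have n: "n = Suc i + j"
      using \<open>i \<in> _\<close> \<open>n > 0\<close> by (auto simp: j_def)
    have dg: "fps_deriv g * \<Phi>\<^sup>2 = \<Phi> - fps_X * fps_deriv \<Phi>"
    proof -
      have "fps_deriv (\<Psi> * \<Phi>) = 0"
        by (simp add: \<Psi>)
      then have "fps_deriv \<Psi> * \<Phi> = - (\<Psi> * fps_deriv \<Phi>)"
        by (simp add: algebra_simps eq_neg_iff_add_eq_0)
      then have "fps_deriv g * \<Phi> = 1 - fps_X * \<Psi> * fps_deriv \<Phi>"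
        unfolding g_def using \<Psi> by (simp add: algebra_simps)
      then have "fps_deriv g * \<Phi> * \<Phi> = (1 - fps_X * \<Psi> * fps_deriv \<Phi>) * \<Phi>"
        by simp
      also have "\<dots> = \<Phi> - fps_X * (\<Psi> * \<Phi>) * fps_deriv \<Phi>"
        by (simp add: algebra_simps)
      finally have "fps_deriv g * \<Phi> * \<Phi> = \<Phi> - fps_X * (\<Psi> * \<Phi>) * fps_deriv \<Phi>" .
      then show ?thesis
        by (simp only: \<Psi>) (simp add: power2_eq_square mult.assoc)
    qed
    have "g ^ i * (fps_deriv g * \<Phi> ^ n) = fps_X ^ i * (\<Psi> ^ i * \<Phi> ^ i) * (fps_deriv g * \<Phi> ^ Suc j)"
      by (simp add: g_def n power_mult_distrib power_add mult_ac)
    then have "(g ^ i * (fps_deriv g * \<Phi> ^ n)) $ (n - 1) = (fps_deriv g * \<Phi> ^ Suc j) $ j"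
      by (simp only: \<Psi>pow mult_1_right mult.assoc fps_X_power_mult_nth) (simp add: n)
    also have "\<dots> = (if i = n - 1 then 1 else 0)"
    proof (cases j)
      case 0
      then show ?thesis using assms by (simp add: n g_def \<Psi>_def)
    next
      case (Suc l)
      have "fps_deriv g * \<Phi> ^ Suc j = (fps_deriv g * \<Phi>\<^sup>2) * \<Phi> ^ l"
        by (simp add: Suc power2_eq_square mult_ac)
      also have "\<dots> = \<Phi> ^ j - fps_X * (\<Phi> ^ l * fps_deriv \<Phi>)"
        unfolding dg by (simp add: Suc algebra_simps)
      finally have *: "fps_deriv g * \<Phi> ^ Suc j = \<Phi> ^ j - fps_X * (\<Phi> ^ l * fps_deriv \<Phi>)" .
      have dp: "fps_deriv (\<Phi> ^ j) = of_nat j * (\<Phi> ^ l * fps_deriv \<Phi>)"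
        by (subst fps_deriv_power) (simp add: Suc fps_of_nat mult_ac del: of_nat_Suc)
      \<comment> \<open>The right side is j f - X f' for f = \<open>\<Phi> ^ j\<close>, which has no
        term of degree \<open>j\<close>; characteristic zero allows cancelling
        \<open>j > 0\<close>.\<close>
      have "of_nat j * (fps_deriv g * \<Phi> ^ Suc j) = of_nat j * \<Phi> ^ j - fps_X * fps_deriv (\<Phi> ^ j)"
        unfolding dp * by (simp add: right_diff_distrib mult_ac del: of_nat_Suc)
      then have "(of_nat j * (fps_deriv g * \<Phi> ^ Suc j)) $ j = 0"
        by (simp add: Suc fps_mult_of_nat_nth del: of_nat_Suc power_Suc)
      then show ?thesis
        by (simp add: fps_mult_of_nat_nth Suc n del: of_nat_Suc)
    qed
    finally show "fps_deriv s $ i * (g ^ i * (fps_deriv g * \<Phi> ^ n)) $ (n - 1)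
        = (if i = n - 1 then fps_deriv s $ i else 0)"
      by simp
  qed
  also have "\<dots> = of_nat n * s $ n"
    using \<open>n > 0\<close> by simp
  finally show ?thesis ..
qed

section \<open>Lucas polynomials and powers of a quadratic series\<close>

text \<open>Power sums of the two roots of T^2 = T + X, see \<open>lucas_binet\<close>.\<close>

fun lucas :: "nat \<Rightarrow> 'a::comm_ring_1 fps" where
  "lucas 0 = 2"
| "lucas (Suc 0) = 1"
| "lucas (Suc (Suc p)) = lucas (Suc p) + fps_X * lucas p"

text \<open>Pascal's rule for both binomials. The guard \<open>k < p\<close> protects against
  truncated subtraction: at \<open>p = k = 1\<close> the formula would yield
  \<open>0 choose 0\<close>.\<close>

lemma lucas_nth_aux:
  "p > 0 \<Longrightarrow> (lucas p :: 'a::comm_ring_1 fps) $ k = of_nat (if k < p then (p - k choose k) + (if k = 0 then 0 else (p - k - 1 choose (k - 1))) else 0)"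
proof (induction p arbitrary: k rule: lucas.induct)
  case (3 p)
  have IH: "(lucas (Suc p) :: 'a fps) $ k = of_nat (if k < Suc p then (Suc p - k choose k) + (if k = 0 then 0 else (Suc p - k - 1 choose (k - 1))) else 0)" for k
    by (rule "3.IH"(1)) (rule zero_less_Suc)
  show ?case
  proof (cases k)
    case 0
    then show ?thesis by (simp add: IH)
  next
    case (Suc l)
    have rec: "(lucas (Suc (Suc p)) :: 'a fps) $ k = lucas (Suc p) $ Suc l + lucas p $ l"
      by (simp add: Suc)
    show ?thesis
    proof (cases "p = 0")
      case True
      then show ?thesis by (auto simp: Suc fps_numeral_nth)
    next
      case False
      then have IH2: "(lucas p :: 'a fps) $ l = of_nat (if l < p then (p - l choose l) + (if l = 0 then 0 else (p - l - 1 choose (l - 1))) else 0)"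
        using "3.IH"(2)[of l] by simp
      show ?thesis
      proof (cases "l < p")
        case True
        define d where "d = p - l - 1"
        have d: "p = Suc d + l" using True by (simp add: d_def)
        show ?thesis
          unfolding rec IH IH2 by (cases l) (simp_all add: Suc d add_ac flip: of_nat_add)
      next
        case False
        then show ?thesis using \<open>p \<noteq> 0\<close> unfolding rec IH IH2
          by (cases "l = p") (auto simp: Suc binomial_eq_0)
      qed
    qed
  qed
qed auto

lemma lucas_nth:
  "k < p \<Longrightarrow> lucas p $ k = of_nat ((p - k choose k) + (if k = 0 then 0 else (p - k - 1 choose (k - 1))))"
  using lucas_nth_aux[of p k] by auto

lemma lucas_binet:
  fixes A B :: "'a::comm_ring_1 fps"
  assumes "A + B = 1" "A * B = - fps_X"
  shows "lucas p = A ^ p + B ^ p"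
proof (induction p rule: lucas.induct)
  case (3 p)
  have "(A ^ Suc p + B ^ Suc p) * (A + B) = A ^ Suc (Suc p) + B ^ Suc (Suc p) + (A * B) * (A ^ p + B ^ p)"
    by (simp add: algebra_simps)
  then show ?case
    using 3 by (simp add: assms)
qed (use assms in auto)

text \<open>Obtained from the fixed point \<beta> = X/(1 + \<beta>). Then 1 + \<beta> and -\<beta>
  have sum 1 and product -X, as \<open>lucas_binet\<close> requires.\<close>

lemma quadratic_series_exists:
  "\<exists>\<beta> :: real fps. \<beta> $ 0 = 0 \<and> \<beta> * (1 + \<beta>) = fps_X"
proof -
  obtain \<beta> :: "real fps" where \<beta>: "\<beta> $ 0 = 0" "\<beta> = fps_X * (inverse (1 + fps_X) oo \<beta>)"
    using fps_fixed_point_exists[of "inverse (1 + fps_X) :: real fps"] by auto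
  have "inverse (1 + fps_X) oo \<beta> = inverse (1 + \<beta>)"
    using \<beta>(1) by (simp add: fps_inverse_compose fps_compose_add_distrib)
  then have "\<beta> * (1 + \<beta>) = fps_X * (inverse (1 + \<beta>) * (1 + \<beta>))"
    using \<beta>(2) by (metis mult.assoc)
  then show ?thesis
    using \<beta>(1) inverse_mult_eq_1[of "1 + \<beta>"] by auto
qed

text \<open>The conjugate root \<open>- \<beta>\<close> of \<open>1 + \<beta>\<close> has no constant term, so its power is invisible below degree \<open>p\<close>.\<close>
lemma quadratic_series_power_nth:
  fixes \<beta> :: "real fps"
  assumes "\<beta> $ 0 = 0" "\<beta> * (1 + \<beta>) = fps_X" "k < p"
  shows "((1 + \<beta>) ^ p) $ k = real ((p - k choose k) + (if k = 0 then 0 else (p - k - 1 choose (k - 1))))"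
proof -
  have "lucas p = (1 + \<beta>) ^ p + (- \<beta>) ^ p"
    using assms by (intro lucas_binet) (simp_all add: algebra_simps)
  moreover have "((- \<beta>) ^ p) $ k = 0"
    using startsby_zero_power_prefix[of "- \<beta>" p] assms by simp
  ultimately show ?thesis
    using lucas_nth[OF \<open>k < p\<close>, where 'a = real] by simp
qed

text \<open>For k > 0 and m = 2n - 1 - k, Pascal's rule makes the left side C(m,k) + 2 C(m,k-1), and
  absorption gives k C(m,k) = 2(n - k) C(m,k-1).\<close>

lemma lucas_coeff_eq:
  assumes "k < n"
  shows "real ((2 * n - k choose k) + (if k = 0 then 0 else (2 * n - k - 1 choose (k - 1))))
       = real n / (real n - real k) * real ((2 * n - 1 - k) choose k)"
proof (cases k)
  case 0
  then show ?thesis using assms by simp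
next
  case (Suc l)
  define d where "d = n - k - 1"
  have n: "n = d + Suc (Suc l)" using assms by (simp add: d_def Suc)
  define m where "m = 2 * d + l + 2"
  have m1: "2 * n - k = Suc m" "2 * n - 1 - k = m" "2 * n - k - 1 = m"
    by (auto simp: n m_def Suc)
  have "Suc l * (m choose Suc l) = (m - l) * (m choose l)"
    using binomial_absorption[of l m] binomial_absorb_comp[of m l] by simp
  moreover have "m - l = 2 * (d + 1)"
    by (simp add: m_def)
  ultimately have "real (Suc l * (m choose Suc l)) = real (2 * (d + 1) * (m choose l))"
    by presburger
  then have "real (m choose l) = real (Suc l) * real (m choose Suc l) / (2 * (real d + 1))"
    by (simp add: field_simps)
  then show ?thesis
    unfolding m1 by (simp add: Suc n field_simps)
qed

section \<open>The substitution u -> s u and the series v\<close>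

text \<open>The series f(s u): \<open>f\<close> has scalar coefficients, those of the result are
  series in the inner variable.\<close>

definition fps_scale :: "'a::comm_ring_1 fps \<Rightarrow> 'a fps \<Rightarrow> 'a fps fps" where
  "fps_scale s f = Abs_fps (\<lambda>n. s ^ n * fps_const (f $ n))"

lemma fps_scale_nth [simp]: "fps_scale s f $ n = s ^ n * fps_const (f $ n)"
  by (simp add: fps_scale_def)

lemma fps_scale_add: "fps_scale s (f + g) = fps_scale s f + fps_scale s g"
  by (simp add: fps_eq_iff[where ?'a = "'a fps"] ring_distribs flip: fps_const_add)

lemma fps_scale_1: "fps_scale s 1 = 1"
  by (rule fps_ext) simp

lemma fps_scale_mult: "fps_scale s (f * g) = fps_scale s f * fps_scale s g"
proof (rule fps_ext)
  fix n
  have const_sum: "fps_const (sum h M) = (\<Sum>i\<in>M. fps_const (h i))" for h :: "nat \<Rightarrow> 'a" and M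
    by (induction M rule: infinite_finite_induct) (auto simp flip: fps_const_add)
  have "fps_const ((f * g) $ n) = (\<Sum>i=0..n. fps_const (f $ i) * fps_const (g $ (n - i)))"
    by (simp add: fps_mult_nth const_sum)
  then have "fps_scale s (f * g) $ n = (\<Sum>i=0..n. s ^ n * (fps_const (f $ i) * fps_const (g $ (n - i))))"
    by (simp add: sum_distrib_left)
  also have "\<dots> = (\<Sum>i=0..n. (s ^ i * fps_const (f $ i)) * (s ^ (n - i) * fps_const (g $ (n - i))))"
  proof (rule sum.cong[OF refl])
    fix i assume "i \<in> {0..n}"
    then have "s ^ n = s ^ i * s ^ (n - i)"
      by (simp flip: power_add)
    then show "s ^ n * (fps_const (f $ i) * fps_const (g $ (n - i)))
      = (s ^ i * fps_const (f $ i)) * (s ^ (n - i) * fps_const (g $ (n - i)))"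
      by (simp only: mult_ac)
  qed
  finally show "fps_scale s (f * g) $ n = (fps_scale s f * fps_scale s g) $ n"
    by (simp add: fps_mult_nth)
qed

text \<open>Solved first over a field, as \<open>fps_fixed_point_exists\<close> demands, by w = X (1
  + w)^2; then s u replaces X, \<open>fps_scale\<close> being a ring homomorphism.\<close>

lemma catalan_series_exists:
  fixes s :: "real fps"
  shows "\<exists>v. v $ 0 = 0 \<and> v = fps_const s * fps_X * (1 + v)\<^sup>2"
proof -
  obtain w :: "real fps" where w: "w $ 0 = 0" "w = fps_X * ((1 + fps_X)\<^sup>2 oo w)"
    using fps_fixed_point_exists[of "(1 + fps_X)\<^sup>2 :: real fps"] by auto
  have "w = fps_X * (1 + w)\<^sup>2"
    by (subst w(2)) (use w(1) in \<open>simp add: fps_compose_power[symmetric] fps_compose_add_distrib\<close>)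
  then have "fps_scale s w = fps_scale s fps_X * ((1 + fps_scale s w) * (1 + fps_scale s w))"
    by (metis fps_scale_mult fps_scale_add fps_scale_1 power2_eq_square)
  moreover have "fps_scale s fps_X = fps_const s * fps_X"
    by (rule fps_ext) (simp add: fps_X_def)
  moreover have "fps_scale s w $ 0 = 0"
    by (simp add: w(1))
  ultimately show ?thesis
    by (metis power2_eq_square)
qed

lemma fps_unit_exists:
  fixes f :: "'a::comm_ring_1 fps"
  assumes "f $ 0 = 1"
  shows "\<exists>g. f * g = 1"
  using fps_right_inverse[of f 1] assms by auto

lemma fls_mult_X_inv_nth: "(fls_X_inv * f) $$ k = (f :: 'a::comm_ring_1 fls) $$ (k + 1)"
  by (simp add: fls_X_inv_times_conv_shift)

lemma fls_mult_X_nth: "(fls_X * f) $$ k = (f :: 'a::comm_ring_1 fls) $$ (k - 1)"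
  by (simp add: fls_X_times_conv_shift)

lemma fls_X_mult_X_inv: "fls_X * fls_X_inv = (1 :: 'a::comm_ring_1 fls)"
  by (rule fls_eqI) (simp add: fls_mult_X_nth)

text \<open>In terms of \<open>t = (1 + v)\<^sup>2 / v = 1 / (s u)\<close>, this is \<open>s ^ j\<close> times the polynomial in \<open>t\<close> which equals
  the symmetric Laurent polynomial \<open>(v ^ j + v ^ (1 - j)) / (1 + v)\<close>.\<close>
fun sym_quot :: "'a::comm_ring_1 \<Rightarrow> nat \<Rightarrow> 'a fls" where
  "sym_quot s 0 = 1"
| "sym_quot s (Suc 0) = fls_const s"
| "sym_quot s (Suc (Suc j)) = (fls_X_inv - 2 * fls_const s) * sym_quot s (Suc j) - (fls_const s)\<^sup>2 * sym_quot s j"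

lemma sym_quot_nth: "k > 0 \<Longrightarrow> sym_quot s j $$ k = 0"
proof (induction s j arbitrary: k rule: sym_quot.induct)
  case (3 s j)
  have *: "fls_const s ^ 2 = fls_const (s ^ 2)" "2 * fls_const s = fls_const (2 * s)"
    by (simp_all add: fls_const_mult_const power2_eq_square flip: fls_const_numeral)
  show ?case using 3
    by (simp add: * left_diff_distrib fls_mult_X_inv_nth)
qed auto

text \<open>The quotients q_j = (v^j + v^(1-j))/(1 + v) satisfy q_(j+2) = (v + 1/v) q_(j+1) - q_j,
  and the hypothesis says s (v + 1/v) = 1/u - 2s. Multiplication by v^j (1 + v) clears
  denominators.\<close>

lemma sym_quot_eq:
  assumes "v * fls_X_inv = fls_const s * (1 + v)\<^sup>2"
  shows "v ^ j * sym_quot s j * (1 + v) = fls_const s ^ j * (v + v ^ (2 * j))"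
  using assms
proof (induction s j rule: sym_quot.induct)
  case (3 s j)
  define S where "S = fls_const s"
  let ?V = "sym_quot s"
  note IH = "3.IH"[OF "3.prems", folded S_def] and v = "3.prems"[folded S_def]
  have "v ^ Suc (Suc j) * ?V (Suc (Suc j)) * (1 + v)
      = (v * fls_X_inv - 2 * S * v) * (v ^ Suc j * ?V (Suc j) * (1 + v)) - S\<^sup>2 * v\<^sup>2 * (v ^ j * ?V j * (1 + v))"
    by (simp add: algebra_simps power2_eq_square flip: S_def)
  also have "\<dots> = (S * (1 + v)\<^sup>2 - 2 * S * v) * (S ^ Suc j * (v + v ^ (2 * Suc j)))
      - S\<^sup>2 * v\<^sup>2 * (S ^ j * (v + v ^ (2 * j)))"
    by (simp only: IH v)
  also have "\<dots> = S ^ Suc (Suc j) * (v + v ^ (2 * Suc (Suc j)))"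
    by (simp add: algebra_simps power2_eq_square power_add)
  finally show ?case
    by (simp only: S_def)
qed (auto simp: algebra_simps power2_eq_square)

section \<open>Solution of the catalytic equation\<close>

lemma fps_to_fls_prod: "fps_to_fls (\<Prod>i\<in>I. f i) = (\<Prod>i\<in>I. fps_to_fls (f i :: 'a::comm_ring_1 fps))"
  by (induction I rule: infinite_finite_induct) (auto simp: fls_times_fps_to_fls)

lemma fls_const_prod: "fls_const (\<Prod>i\<in>X. f i :: 'a::comm_ring_1) = (\<Prod>i\<in>X. fls_const (f i))"
  by (induction X rule: infinite_finite_induct) (auto simp flip: fls_const_mult_const)

lemma prod_one_plus_fps_nth:
  fixes v :: "'a::comm_ring_1 fps"
  assumes "finite I" "v $ 0 = 0"
  shows "(\<Prod>i\<in>I. 1 + fps_const (a i) * v) $ 0 = 1"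
    and "(\<Prod>i\<in>I. 1 + fps_const (a i) * v) $ 1 = (\<Sum>i\<in>I. a i) * v $ 1"
  using assms
  by (induction I rule: finite_induct) (auto simp: fps_mult_nth_1 algebra_simps)

text \<open>In \<open>real fps fps\<close> the outer variable is u and the inner one z:
  \<open>fps_X\<close> is z in the equation for \<open>s\<close> and u in that for \<open>v\<close>,
  where z would be \<open>fps_const fps_X\<close>.\<close>

locale catalytic =
  fixes I :: "nat set" and x :: "nat \<Rightarrow> real" and s :: "real fps" and B :: "nat \<Rightarrow> real fps"
    and v :: "real fps fps"
  assumes fin: "finite I"
    and s0: "s \<noteq> 0"
    and s: "s = fps_X * (\<Prod>i\<in>I. (B i)\<^sup>2)"
    and B: "(B i)\<^sup>2 = B i + fps_const (x i) * s"
    and B0: "B i $ 0 = 1"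
    and v0: "v $ 0 = 0"
    and v: "v = fps_const s * fps_X * (1 + v)\<^sup>2"
begin

text \<open>Writing a_i as \<open>s * b i\<close> supplies the powers of s contained in
  \<open>sym_quot\<close>; the form 1 - 1/B_i is \<open>B_a\<close>.\<close>

definition b where "b i = fps_const (x i) * (inverse (B i))\<^sup>2"
definition a where "a i = s * b i"

lemma B_inverse: "B i * inverse (B i) = 1"
  using B0[of i] by (simp add: inverse_mult_eq_1')

lemma B_a: "B i * a i = B i - 1"
proof -
  have "B i * (B i * a i) = fps_const (x i) * s * (B i * inverse (B i))\<^sup>2"
    by (simp add: a_def b_def power2_eq_square mult_ac)
  also have "\<dots> = B i * (B i - 1)"
    using B[of i] by (simp add: B_inverse algebra_simps power2_eq_square)
  finally show ?thesis
    using B0[of i] by (metis fps_nonzero_nth mult_left_cancel zero_neq_one)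
qed

text \<open>The coefficients needed to expand B^2 (1 + a v)(v + a). By \<open>B_a\<close>, the
  second is B^2 + (B - 1)^2 = 1 + 2 (B^2 - B).\<close>

lemma B_a_quadratic:
  "(B i)\<^sup>2 * a i = fps_const (x i) * s" "(B i)\<^sup>2 * (1 + (a i)\<^sup>2) = 1 + 2 * fps_const (x i) * s"
proof -
  show 1: "(B i)\<^sup>2 * a i = fps_const (x i) * s"
  proof -
    have "(B i)\<^sup>2 * a i = B i * (B i * a i)"
      by (simp add: power2_eq_square mult.assoc)
    also have "\<dots> = (B i)\<^sup>2 - B i"
      unfolding B_a by (simp add: power2_eq_square algebra_simps)
    finally show ?thesis
      using B[of i] by simp
  qed
  have "(B i)\<^sup>2 * (1 + (a i)\<^sup>2) = (B i)\<^sup>2 + (B i * a i)\<^sup>2"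
    by (simp add: algebra_simps power2_eq_square)
  also have "\<dots> = 1 + 2 * fps_const (x i) * s"
    unfolding B_a using B[of i] by (simp add: algebra_simps power2_eq_square)
  finally show "(B i)\<^sup>2 * (1 + (a i)\<^sup>2) = 1 + 2 * fps_const (x i) * s" .
qed

definition A where "A = (\<Prod>i\<in>I. 1 + fps_const (a i) * v)"
text \<open>Inverses are taken by choice because the coefficient ring \<open>real fps\<close> is not
  a field.\<close>

definition A_inv where "A_inv = (SOME g. A * g = 1)"
definition w_inv where "w_inv = (SOME g. (1 + v) * g = 1)"
definition F where "F = (1 + v) * A_inv"
definition G where "G = A * w_inv"
definition E :: "real fps fls" where "E = (\<Prod>i\<in>I. 1 + fls_const (fps_const (x i)) * fls_X_inv)"

lemma A0: "A $ 0 = 1"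
  unfolding A_def by (rule prod_one_plus_fps_nth[OF fin v0])

lemma A_inv: "A * A_inv = 1"
  unfolding A_inv_def by (rule someI_ex) (rule fps_unit_exists[OF A0])

lemma w_inv: "(1 + v) * w_inv = 1"
  unfolding w_inv_def by (rule someI_ex) (rule fps_unit_exists, simp add: v0)

lemma A_F: "A * F = 1 + v"
  using A_inv by (simp add: F_def mult.left_commute)

lemma G_w: "(1 + v) * G = A"
  using w_inv by (simp add: G_def mult.left_commute)

lemma F_G: "F * G = 1"
proof -
  have "F * G = (A * A_inv) * ((1 + v) * w_inv)"
    by (simp add: F_def G_def mult_ac)
  then show ?thesis by (simp add: A_inv w_inv)
qed

lemma v1: "v $ 1 = s"
proof -
  have "v $ 1 = (fps_const s * (fps_X * (1 + v)\<^sup>2)) $ 1"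
    by (subst v) (simp add: mult.assoc)
  also have "\<dots> = s"
    by (simp add: v0 power2_eq_square)
  finally show ?thesis .
qed

lemma G0: "G $ 0 = 1"
  using arg_cong[OF G_w, of "\<lambda>f. f $ 0"] by (simp add: A0 v0)

text \<open>First-order expansion of (1 + v)/A, where v = s u + O(u^2).\<close>

lemma F1: "F $ 1 = s - s * (\<Sum>i\<in>I. a i)"
proof -
  have "F $ 0 = 1"
    using arg_cong[OF A_F, of "\<lambda>f. f $ 0"] by (simp add: A0 v0)
  moreover have "A $ 1 = (\<Sum>i\<in>I. a i) * s"
    unfolding A_def prod_one_plus_fps_nth[OF fin v0] v1 ..
  ultimately show ?thesis
    using arg_cong[OF A_F, of "\<lambda>f. f $ 1"] by (simp add: A0 v1[unfolded One_nat_def] fps_mult_nth_1 algebra_simps)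
qed

abbreviation vl where "vl \<equiv> fps_to_fls v"

lemma vl_X_inv: "vl * fls_X_inv = fls_const s * (1 + vl)\<^sup>2"
proof -
  have "vl = fls_const s * fls_X * (1 + vl)\<^sup>2"
    using arg_cong[OF v, of fps_to_fls] by (simp add: fls_times_fps_to_fls power2_eq_square)
  then have "vl * fls_X_inv = (fls_const s * fls_X * (1 + vl)\<^sup>2) * fls_X_inv"
    by (rule arg_cong)
  also have "\<dots> = (fls_X * fls_X_inv) * (fls_const s * (1 + vl)\<^sup>2)"
    by (simp only: mult_ac)
  finally show ?thesis
    by (simp only: fls_X_mult_X_inv mult_1)
qed

text \<open>\<open>A\<close> with v replaced by 1/v, cleared of denominators by
  \<open>v ^ card I\<close>.\<close>

definition A_rev where "A_rev = (\<Prod>i\<in>I. vl + fls_const (a i))"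

text \<open>The left side expands to v + 2 x s v + x s (1 + v^2) = v + x s (1 + v)^2, and s (1 +
  v)^2 = v/u.\<close>

lemma kernel_factor:
  "fls_const ((B i)\<^sup>2) * (1 + fls_const (a i) * vl) * (vl + fls_const (a i))
    = vl * (1 + fls_const (fps_const (x i)) * fls_X_inv)"
proof -
  define c al X S where "c = fls_const ((B i)\<^sup>2)" and "al = fls_const (a i)"
    and "X = fls_const (fps_const (x i))" and "S = fls_const s"
  have q: "c * al = X * S" "c * (1 + al\<^sup>2) = 1 + 2 * X * S"
  proof -
    show "c * al = X * S"
      using B_a_quadratic(1)[of i] by (simp add: c_def al_def X_def S_def)
    have "c * (1 + al\<^sup>2) = fls_const ((B i)\<^sup>2 * (1 + (a i)\<^sup>2))"
      by (simp add: c_def al_def power2_eq_square distrib_left flip: fls_plus_const)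
    then show "c * (1 + al\<^sup>2) = 1 + 2 * X * S"
      unfolding B_a_quadratic(2) X_def S_def
      by (simp flip: fls_plus_const fls_const_numeral)
  qed
  have "c * (1 + al * vl) * (vl + al) = (c * (1 + al\<^sup>2)) * vl + (c * al) * (1 + vl\<^sup>2)"
    by (simp add: algebra_simps power2_eq_square)
  also have "\<dots> = vl + X * (S * (1 + vl)\<^sup>2)"
    unfolding q by (simp add: algebra_simps power2_eq_square)
  also have "\<dots> = vl * (1 + X * fls_X_inv)"
    by (simp add: algebra_simps S_def flip: vl_X_inv)
  finally show ?thesis
    by (simp only: c_def al_def X_def)
qed

lemma A_fls: "fps_to_fls A = (\<Prod>i\<in>I. 1 + fls_const (a i) * vl)"
  by (simp add: A_def fps_to_fls_prod fls_times_fps_to_fls)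

lemma E_eq: "vl ^ card I * E = fls_const (\<Prod>i\<in>I. (B i)\<^sup>2) * fps_to_fls A * A_rev"
proof -
  have *: "fls_const (\<Prod>i\<in>I. (B i)\<^sup>2) = (\<Prod>i\<in>I. fls_const ((B i)\<^sup>2))"
    by (rule fls_const_prod)
  show ?thesis
    unfolding * A_fls A_rev_def E_def prod.distrib[symmetric] kernel_factor
    by (simp add: prod.distrib)
qed

lemma v_nonzero: "vl \<noteq> 0" "1 + vl \<noteq> 0"
proof -
  have "v \<noteq> 0" "(1 + v) $ 0 \<noteq> 0"
    using v1 s0 v0 by auto
  then have "v \<noteq> 0" "1 + v \<noteq> 0"
    by (metis fps_zero_nth)+
  then show "vl \<noteq> 0" "1 + vl \<noteq> 0"
    by (simp_all flip: fps_to_fls_eq_0_iff)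
qed

text \<open>The polynomial in 1/u that turns out to be z u F E + 1/F.\<close>

definition N where "N = (\<Sum>X\<in>Pow I. fls_const (\<Prod>i\<in>X. b i) * sym_quot s (card X))"

text \<open>Expanding both products over subsets X of \<open>I\<close>, the term of X on the left is
  the product of its a_i times v^|I| (v^j + v^(1-j)) with j = |X|, which \<open>sym_quot_eq\<close>
  divides by 1 + v.\<close>

lemma symmetrize: "vl * A_rev + vl ^ card I * fps_to_fls A = vl ^ card I * (1 + vl) * N"
proof -
  let ?m = "card I"
  define as where "as X = fls_const (\<Prod>i\<in>X. b i) * fls_const s ^ card X" for X
  have as: "(\<Prod>i\<in>X. fls_const (a i)) = as X" for X
    unfolding as_def a_def fls_const_prod fls_const_mult_const[symmetric] prod.distrib
    by (simp only: prod_constant mult_ac)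
  have "A_rev = (\<Prod>i\<in>I. fls_const (a i) + vl)"
    by (simp add: A_rev_def add.commute)
  also have "\<dots> = (\<Sum>X\<in>Pow I. as X * vl ^ card (I - X))"
    by (simp add: prod_add fin as)
  finally have 1: "A_rev = \<dots>" .
  have "fps_to_fls A = (\<Prod>i\<in>I. fls_const (a i) * vl + 1)"
    by (simp add: A_fls add.commute)
  also have "\<dots> = (\<Sum>X\<in>Pow I. as X * vl ^ card X)"
    by (simp add: prod_add fin prod.distrib as)
  finally have 2: "fps_to_fls A = \<dots>" .
  have "vl * A_rev + vl ^ ?m * fps_to_fls A
      = (\<Sum>X\<in>Pow I. as X * (vl * vl ^ card (I - X) + vl ^ ?m * vl ^ card X))"
    by (simp add: 1 2 sum_distrib_left sum.distrib[symmetric] algebra_simps)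
  also have "\<dots> = (\<Sum>X\<in>Pow I. vl ^ ?m * (1 + vl) * (fls_const (\<Prod>i\<in>X. b i) * sym_quot s (card X)))"
  proof (rule sum.cong[OF refl])
    fix X assume "X \<in> Pow I"
    then have X: "card (I - X) + card X = ?m"
      using fin by (metis Pow_iff add.commute card_Diff_subset card_mono finite_subset le_add_diff_inverse)
    let ?j = "card X" let ?d = "card (I - X)"
    have "vl ^ ?m * (1 + vl) * sym_quot s ?j = vl ^ ?d * (vl ^ ?j * sym_quot s ?j * (1 + vl))"
      by (simp add: X[symmetric] power_add mult_ac)
    also have "\<dots> = fls_const s ^ ?j * (vl * vl ^ ?d + vl ^ ?m * vl ^ ?j)"
      unfolding sym_quot_eq[OF vl_X_inv] X[symmetric]
      by (simp add: algebra_simps power_add mult_2_right)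
    finally show "as X * (vl * vl ^ ?d + vl ^ ?m * vl ^ ?j)
        = vl ^ ?m * (1 + vl) * (fls_const (\<Prod>i\<in>X. b i) * sym_quot s ?j)"
      by (simp add: as_def mult_ac)
  qed
  finally show ?thesis
    by (simp add: N_def sum_distrib_left)
qed

text \<open>By \<open>E_eq\<close>, z u E F = s u (1 + v) A_rev / v^|I| = v A_rev / (v^|I| (1 + v)),
  while G = A/(1 + v); \<open>symmetrize\<close> adds the two. The common denominator is cancelled
  at the end.\<close>

lemma kernel_identity:
  "fls_const fps_X * (fls_X * (E * fps_to_fls F)) + fps_to_fls G = N"
proof -
  let ?D = "vl ^ card I * (1 + vl)"
  have "?D * (fls_const fps_X * (fls_X * (E * fps_to_fls F)))
      = fls_const fps_X * fls_X * (1 + vl) * (vl ^ card I * E) * fps_to_fls F"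
    by (simp add: mult_ac)
  also have "\<dots> = (fls_const (fps_X * (\<Prod>i\<in>I. (B i)\<^sup>2)) * fls_X * (1 + vl)) * A_rev * (fps_to_fls (A * F))"
    unfolding E_eq fls_const_mult_const[symmetric] fls_times_fps_to_fls by (simp only: mult_ac)
  also have "\<dots> = fls_const s * fls_X * (1 + vl)\<^sup>2 * A_rev"
    unfolding A_F s[symmetric] by (simp add: mult_ac power2_eq_square)
  also have "\<dots> = (vl * fls_X_inv) * fls_X * A_rev"
    unfolding vl_X_inv by (simp add: mult_ac)
  also have "\<dots> = vl * A_rev"
    by (simp add: mult_ac fls_X_mult_X_inv)
  finally have 1: "?D * (fls_const fps_X * (fls_X * (E * fps_to_fls F))) = vl * A_rev" .
  have "?D * fps_to_fls G = vl ^ card I * fps_to_fls ((1 + v) * G)"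
    by (simp add: fls_times_fps_to_fls)
  then have "?D * fps_to_fls G = vl ^ card I * fps_to_fls A"
    by (simp add: G_w)
  with 1 have "?D * (fls_const fps_X * (fls_X * (E * fps_to_fls F)) + fps_to_fls G) = ?D * N"
    by (simp add: distrib_left symmetrize)
  moreover have "?D \<noteq> 0"
    using v_nonzero by simp
  ultimately show ?thesis
    by (metis mult_left_cancel)
qed

lemma N_nth: "k > 0 \<Longrightarrow> N $$ k = 0"
  by (simp add: N_def fls_nth_sum sym_quot_nth)

text \<open>\<open>N\<close> has no positive powers of u, so \<open>kernel_identity\<close> gives z
  u H = 1 - G in these degrees; multiplying by F = 1/G yields the equation.\<close>

lemma functional_equation:
  "F = 1 + fps_const fps_X * fps_X * F * fls_regpart (E * fps_to_fls F)"
proof -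
  let ?H = "fls_regpart (E * fps_to_fls F)"
  have "fps_const fps_X * (fps_X * ?H) = 1 - G"
  proof (rule fps_ext)
    fix l
    show "(fps_const fps_X * (fps_X * ?H)) $ l = (1 - G) $ l"
    proof (cases l)
      case 0
      then show ?thesis by (simp add: G0)
    next
      case (Suc k)
      have "(fls_const fps_X * (fls_X * (E * fps_to_fls F)) + fps_to_fls G) $$ (int k + 1) = 0"
        unfolding kernel_identity by (rule N_nth) simp
      then have "fps_X * (E * fps_to_fls F) $$ int k + G $ Suc k = 0"
        by (simp add: fls_mult_X_nth nat_add_distrib)
      then show ?thesis
        by (simp add: Suc eq_neg_iff_add_eq_0)
    qed
  qed
  then have "F * (fps_const fps_X * (fps_X * ?H)) = F * (1 - G)"
    by simp
  also have "\<dots> = F - 1"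
    by (simp add: right_diff_distrib F_G)
  finally show ?thesis
    by (simp add: algebra_simps)
qed

end

section \<open>The derivative of the coefficient of u\<close>

lemma fps_log_deriv_prod:
  fixes f :: "'b \<Rightarrow> 'a::comm_ring_1 fps"
  assumes "finite I" "\<And>i. i \<in> I \<Longrightarrow> fps_deriv (f i) = f i * l i"
  shows "fps_deriv (\<Prod>i\<in>I. f i) = (\<Prod>i\<in>I. f i) * (\<Sum>i\<in>I. l i)"
  using assms by (induction I rule: finite_induct) (auto simp: algebra_simps)

context catalytic
begin

text \<open>Here \<theta> is z d/dz. With \<open>L i\<close> = \<theta>(B_i)/B_i, the equation for s
  gives \<theta>(s) = s + s \<Sum> 2 L_i, while \<theta>(s a_i) = 2 s L_i, so the sums cancel in
  \<theta>(s - s \<Sum> a_i).\<close>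

lemma deriv_F1: "fps_X * fps_deriv (F $ 1) = s"
proof -
  define \<theta> where "\<theta> f = fps_X * fps_deriv f" for f :: "real fps"
  have \<theta>_mult: "\<theta> (f * g) = \<theta> f * g + f * \<theta> g" for f g
    by (simp add: \<theta>_def algebra_simps)
  define L where "L i = inverse (B i) * \<theta> (B i)" for i
  have BL: "B i * L i = \<theta> (B i)" for i
    using B_inverse[of i] by (simp add: L_def flip: mult.assoc)
  have "fps_deriv ((B i)\<^sup>2) = (B i)\<^sup>2 * (2 * (inverse (B i) * fps_deriv (B i)))" for i
  proof -
    have "(B i)\<^sup>2 * (2 * (inverse (B i) * fps_deriv (B i))) = (B i * inverse (B i)) * (2 * (B i * fps_deriv (B i)))"
      by (simp add: power2_eq_square mult_ac)
    then show ?thesis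
      by (simp add: B_inverse power2_eq_square algebra_simps)
  qed
  then have "fps_deriv (\<Prod>i\<in>I. (B i)\<^sup>2) = (\<Prod>i\<in>I. (B i)\<^sup>2) * (\<Sum>i\<in>I. 2 * (inverse (B i) * fps_deriv (B i)))"
    by (intro fps_log_deriv_prod fin) auto
  then have "\<theta> (\<Prod>i\<in>I. (B i)\<^sup>2) = (\<Prod>i\<in>I. (B i)\<^sup>2) * (\<Sum>i\<in>I. 2 * L i)"
    by (simp add: \<theta>_def L_def sum_distrib_left mult_ac)
  then have \<theta>s: "\<theta> s = s + s * (\<Sum>i\<in>I. 2 * L i)"
    by (subst (1 2 3) s) (simp add: \<theta>_mult mult.assoc, simp add: \<theta>_def)
  have tm: "\<theta> (s * a i) = s * (2 * L i)" for i
  proof -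
    \<comment> \<open>Differentiating the quadratic equation brings in x_i, which is eliminated by
      multiplying with s and using x_i s = B_i^2 - B_i.\<close>
    have "\<theta> (B i * B i) = \<theta> (B i) + fps_const (x i) * \<theta> s"
      using B[of i] by (simp add: power2_eq_square) (simp add: \<theta>_def algebra_simps)
    then have "(2 * B i - 1) * \<theta> (B i) = fps_const (x i) * \<theta> s"
      by (simp add: \<theta>_mult algebra_simps)
    then have "s * ((2 * B i - 1) * \<theta> (B i)) = (fps_const (x i) * s) * \<theta> s"
      by simp
    also have "fps_const (x i) * s = (B i)\<^sup>2 - B i"
      using B[of i] by simp
    finally have 1: "((B i)\<^sup>2 - B i) * \<theta> s + s * \<theta> (B i) = 2 * s * B i * \<theta> (B i)"
      by (simp add: algebra_simps)
    have "\<theta> (B i * a i) = \<theta> (B i)"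
      unfolding B_a by (simp add: \<theta>_def)
    then have "B i * \<theta> (B i) = \<theta> (B i) * (B i * a i) + (B i)\<^sup>2 * \<theta> (a i)"
      unfolding \<theta>_mult by (metis (no_types) distrib_left mult.assoc mult.commute power2_eq_square)
    then have 2: "(B i)\<^sup>2 * \<theta> (a i) = \<theta> (B i)"
      unfolding B_a by (simp add: algebra_simps)
    have "(B i)\<^sup>2 * \<theta> (s * a i) = B i * (B i * a i) * \<theta> s + s * ((B i)\<^sup>2 * \<theta> (a i))"
      by (simp add: \<theta>_mult algebra_simps power2_eq_square)
    also have "\<dots> = 2 * s * B i * \<theta> (B i)"
      unfolding 2 B_a 1[symmetric] by (simp add: algebra_simps power2_eq_square)
    also have "\<dots> = (B i)\<^sup>2 * (s * (2 * L i))"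
      unfolding BL[symmetric] by (simp add: mult_ac power2_eq_square)
    finally show ?thesis
      using B0[of i] by (metis fps_zero_nth mult_left_cancel power_not_zero zero_neq_one)
  qed
  have "fps_X * fps_deriv (F $ 1) = \<theta> s - (\<Sum>i\<in>I. \<theta> (s * a i))"
    unfolding F1 \<theta>_def by (simp add: sum_distrib_left right_diff_distrib fps_deriv_sum)
  also have "\<dots> = s"
    unfolding tm \<theta>s by (simp add: sum_distrib_left)
  finally show ?thesis .
qed

end

section \<open>Coefficient extraction by Lagrange inversion\<close>

lemma fps_prod_nth:
  fixes f :: "'b \<Rightarrow> 'a::comm_ring_1 fps"
  assumes "finite I"
  shows "(\<Prod>i\<in>I. f i) $ N = (\<Sum>k | k \<in> I \<rightarrow>\<^sub>E {..N} \<and> sum k I = N. \<Prod>i\<in>I. f i $ k i)"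
  using assms
proof (induction I arbitrary: N rule: finite_induct)
  case empty
  have "{k :: 'b \<Rightarrow> nat. k = (\<lambda>x. undefined) \<and> 0 = N} = (if N = 0 then {\<lambda>x. undefined} else {})"
    by auto
  then show ?case by simp
next
  case (insert i I)
  let ?K = "\<lambda>I (N::nat). {k. k \<in> I \<rightarrow>\<^sub>E {..N} \<and> sum k I = N}"
  have fin: "finite (?K I N)" for N :: nat
    by (rule finite_subset[OF _ finite_PiE[of I "\<lambda>_. {..N}"]]) (use insert.hyps in auto)
  have "(\<Prod>i\<in>insert i I. f i) $ N = (\<Sum>j\<in>{0..N}. \<Sum>k\<in>?K I (N - j). f i $ j * (\<Prod>i\<in>I. f i $ k i))"
    using insert by (simp add: fps_mult_nth sum_distrib_left)
  also have "\<dots> = (\<Sum>(j, k)\<in>(SIGMA j:{0..N}. ?K I (N - j)). f i $ j * (\<Prod>i\<in>I. f i $ k i))"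
    by (rule sum.Sigma) (auto simp: fin)
  also have "\<dots> = (\<Sum>k\<in>?K (insert i I) N. \<Prod>i\<in>insert i I. f i $ k i)"
  \<comment> \<open>An exponent vector on \<open>insert i I\<close> corresponds to its value at
    \<open>i\<close> and the vector reset to \<open>undefined\<close> there, which keeps it
    extensional on \<open>I\<close>.\<close>
  proof (rule sum.reindex_bij_witness[of _ "\<lambda>k. (k i, k(i := undefined))" "\<lambda>(j, k). k(i := j)"])
    fix p assume p: "p \<in> (SIGMA j:{0..N}. ?K I (N - j))"
    obtain j k where [simp]: "p = (j, k)" by force
    have jk: "j \<le> N" "k \<in> I \<rightarrow>\<^sub>E {..N - j}" "sum k I = N - j"
      using p by auto
    show "(\<lambda>k. (k i, k(i := undefined))) ((\<lambda>(j, k). k(i := j)) p) = p"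
      using jk insert.hyps by (auto simp: PiE_def extensional_def)
    have s: "(\<Sum>l\<in>I. if l = i then j else k l) = sum k I"
      using insert.hyps by (intro sum.cong) auto
    show "(\<lambda>(j, k). k(i := j)) p \<in> ?K (insert i I) N"
    proof -
      have "k l \<le> N" if "l \<in> I" for l
        using jk(2) that by (fastforce simp: PiE_def Pi_def)
      then show ?thesis
        using jk insert.hyps s by (auto simp: PiE_def extensional_def fun_upd_def)
    qed
    show "(\<Prod>l\<in>insert i I. f l $ (\<lambda>(j, k). k(i := j)) p l) = (case p of (j, k) \<Rightarrow> f i $ j * (\<Prod>i\<in>I. f i $ k i))"
      using insert.hyps by (simp, intro arg_cong[where f = "\<lambda>t. _ * t"] prod.cong) auto
  next
    fix k assume k: "k \<in> ?K (insert i I) N"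
    then have s: "k i + sum k I = N"
      using insert.hyps by simp
    show "(\<lambda>(j, k). k(i := j)) (k i, k(i := undefined)) = k"
      by simp
    have s': "(\<Sum>l\<in>I. if l = i then undefined else k l) = sum k I"
      using insert.hyps by (intro sum.cong) auto
    have "k l \<le> N - k i" if "l \<in> I" for l
      using member_le_sum[of l I k] that insert.hyps s by simp
    then show "(k i, k(i := undefined)) \<in> (SIGMA j:{0..N}. ?K I (N - j))"
      using k s s' insert.hyps by (auto simp: PiE_def extensional_def Pi_def fun_upd_def)
  qed
  finally show ?case .
qed

lemma catalytic_solution_exists:
  fixes x :: "nat \<Rightarrow> real"
  assumes fin: "finite I"
  shows "\<exists>F :: real fps fps.
    F = 1 + fps_const fps_X * fps_X * F *
      fls_regpart ((\<Prod>i\<in>I. 1 + fls_const (fps_const (x i)) * fls_X_inv) * fps_to_fls F) \<and>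
    (\<forall>n>0. (F $ 1) $ n = 1 / real n ^ 2 *
       (\<Sum>k | k \<in> I \<rightarrow>\<^sub>E {..n-1} \<and> sum k I = n - 1.
          \<Prod>i\<in>I. x i ^ k i * (real n / (real n - real (k i)) * real ((2 * n - 1 - k i) choose (k i)))))"
proof -
  obtain \<beta> :: "real fps" where \<beta>: "\<beta> $ 0 = 0" "\<beta> * (1 + \<beta>) = fps_X"
    using quadratic_series_exists by blast
  \<comment> \<open>As a series in y, \<open>\<gamma> i\<close> solves \<gamma>^2 = \<gamma> + x_i
    y; substituting y = s gives the B_i of the locale.\<close>
  define \<gamma> where "\<gamma> i = (1 + \<beta>) oo (fps_const (x i) * fps_X)" for i
  define \<Phi> where "\<Phi> = (\<Prod>i\<in>I. (\<gamma> i)\<^sup>2)"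
  have \<Phi>0: "\<Phi> $ 0 = 1"
    unfolding \<Phi>_def using fin by (induction I rule: finite_induct) (auto simp: \<gamma>_def \<beta> power2_eq_square)
  obtain s where fixpoint: "s $ 0 = 0" "s = fps_X * (\<Phi> oo s)"
    using fps_fixed_point_exists[of \<Phi>] \<Phi>0 by auto
  define B where "B i = \<gamma> i oo s" for i
  obtain v where v: "v $ 0 = 0" "v = fps_const s * fps_X * (1 + v)\<^sup>2"
    using catalan_series_exists by blast
  have "\<Phi> oo s = (\<Prod>i\<in>I. (B i)\<^sup>2)"
    using fixpoint(1) by (simp add: \<Phi>_def B_def fps_compose_prod_distrib fps_compose_power)
  moreover have "(\<gamma> i)\<^sup>2 = \<gamma> i + fps_const (x i) * fps_X" for i
  proof -
    have "(1 + \<beta>)\<^sup>2 = (1 + \<beta>) + fps_X"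
      using \<beta>(2) by (simp add: power2_eq_square algebra_simps)
    then have "(1 + \<beta>)\<^sup>2 oo (fps_const (x i) * fps_X) = ((1 + \<beta>) + fps_X) oo (fps_const (x i) * fps_X)"
      by simp
    then show ?thesis
      by (subst (asm) fps_compose_power[symmetric]) (simp_all add: \<gamma>_def fps_compose_add_distrib)
  qed
  then have "(B i)\<^sup>2 = B i + fps_const (x i) * s" for i
    using fixpoint(1) by (simp add: B_def fps_compose_add_distrib fps_compose_mult_distrib fps_compose_power)
  moreover have "s \<noteq> 0"
    using fixpoint(2) \<Phi>0 by auto
  ultimately interpret catalytic I x s B v
    using fin fixpoint v by unfold_locales (auto simp: B_def \<gamma>_def \<beta>)
  have "(F $ 1) $ n = 1 / real n ^ 2 *
       (\<Sum>k | k \<in> I \<rightarrow>\<^sub>E {..n-1} \<and> sum k I = n - 1.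
          \<Prod>i\<in>I. x i ^ k i * (real n / (real n - real (k i)) * real ((2 * n - 1 - k i) choose (k i))))"
    if n: "n > 0" for n
  proof -
    \<comment> \<open>One factor n comes from \<open>deriv_F1\<close>, the other from Lagrange
      inversion.\<close>
    have "real n * (F $ 1) $ n = s $ n"
      using arg_cong[OF deriv_F1, of "\<lambda>f. f $ n"] n by simp
    then have "real n ^ 2 * (F $ 1) $ n = (\<Phi> ^ n) $ (n - 1)"
      using fps_lagrange_inversion[OF _ fixpoint n] \<Phi>0 by (simp add: power2_eq_square mult.assoc)
    also have "\<Phi> ^ n = (\<Prod>i\<in>I. \<gamma> i ^ (2 * n))"
      by (simp add: \<Phi>_def prod_power_distrib power_mult)
    also have "\<dots> $ (n - 1) = (\<Sum>k | k \<in> I \<rightarrow>\<^sub>E {..n-1} \<and> sum k I = n - 1. \<Prod>i\<in>I. (\<gamma> i ^ (2 * n)) $ k i)"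
      by (rule fps_prod_nth[OF fin])
    also have "\<dots> = (\<Sum>k | k \<in> I \<rightarrow>\<^sub>E {..n-1} \<and> sum k I = n - 1.
          \<Prod>i\<in>I. x i ^ k i * (real n / (real n - real (k i)) * real ((2 * n - 1 - k i) choose (k i))))"
    proof (intro sum.cong refl prod.cong)
      fix k i assume k: "k \<in> {k. k \<in> I \<rightarrow>\<^sub>E {..n-1} \<and> sum k I = n - 1}" and i: "i \<in> I"
      then have "k i \<in> {..n-1}" by (auto dest: PiE_mem)
      then have kn: "k i < n" using n by auto
      have "\<gamma> i ^ (2 * n) = (1 + \<beta>) ^ (2 * n) oo (fps_const (x i) * fps_X)"
        by (simp add: \<gamma>_def fps_compose_power)
      then have "(\<gamma> i ^ (2 * n)) $ k i = x i ^ k i * ((1 + \<beta>) ^ (2 * n)) $ k i"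
        by (simp add: fps_compose_linear)
      also have "((1 + \<beta>) ^ (2 * n)) $ k i = real n / (real n - real (k i)) * real ((2 * n - 1 - k i) choose (k i))"
        by (subst quadratic_series_power_nth[OF \<beta>]) (use kn in simp, rule lucas_coeff_eq[OF kn])
      finally show "(\<gamma> i ^ (2 * n)) $ k i = x i ^ k i * (real n / (real n - real (k i)) * real ((2 * n - 1 - k i) choose (k i)))" .
    qed
    finally show ?thesis
      using n by (simp add: field_simps)
  qed
  then show ?thesis
    using functional_equation unfolding E_def by blast
qed

section \<open>Comparison of coefficients\<close>

lemma esym_gt: "j > k \<Longrightarrow> esym k x j = 0"
  by (induction k arbitrary: j) (auto simp: esym_Suc, simp add: esym_def)

text \<open>\<open>h\<close> stands for the embedding of the reals into Laurent series over
  \<open>real fps\<close>, and \<open>T\<close> for 1/u.\<close>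

lemma prod_one_plus_esym:
  fixes T :: "'a::comm_ring_1"
  assumes h: "h 1 = 1" "h 0 = 0" "\<And>a b. h (a + b) = h a + h b" "\<And>a b. h (a * b) = h a * h b"
  shows "(\<Prod>i<k. 1 + h (x i) * T) = (\<Sum>j\<le>k. h (esym k x j) * T ^ j)"
proof (induction k)
  case 0
  then show ?case by (simp add: esym_def h)
next
  case (Suc k)
  have "(\<Sum>j\<le>Suc k. h (esym (Suc k) x j) * T ^ j)
    = (\<Sum>j\<le>Suc k. h (esym k x j) * T ^ j) + (\<Sum>j\<le>Suc k. (if j = 0 then 0 else h (x k) * h (esym k x (j - 1))) * T ^ j)"
    by (simp add: esym_Suc h sum.distrib[symmetric] distrib_right if_distrib[of h] del: sum.atMost_Suc cong: if_cong)
  also have "(\<Sum>j\<le>Suc k. h (esym k x j) * T ^ j) = (\<Sum>j\<le>k. h (esym k x j) * T ^ j)"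
    by (simp add: esym_gt h)
  also have "(\<Sum>j\<le>Suc k. (if j = 0 then 0 else h (x k) * h (esym k x (j - 1))) * T ^ j)
    = (\<Sum>j\<le>k. h (x k) * h (esym k x j) * T ^ Suc j)"
    by (simp add: sum.atMost_Suc_shift del: sum.atMost_Suc)
  also have "\<dots> = h (x k) * T * (\<Sum>j\<le>k. h (esym k x j) * T ^ j)"
    by (simp add: sum_distrib_left mult_ac)
  finally have *: "(\<Sum>j\<le>Suc k. h (esym (Suc k) x j) * T ^ j) =
    (\<Sum>j\<le>k. h (esym k x j) * T ^ j) + h (x k) * T * (\<Sum>j\<le>k. h (esym k x j) * T ^ j)" .
  show ?case
    by (simp only: * prod.lessThan_Suc Suc) (simp add: algebra_simps)
qed

lemma fls_X_inv_power_mult_nth: "(fls_X_inv ^ j * f) $$ k = (f :: 'a::comm_ring_1 fls) $$ (k + int j)"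
  by (induction j arbitrary: k) (simp_all add: mult.assoc fls_mult_X_inv_nth add_ac)

text \<open>The functional equation determines the coefficients by induction on \<open>n\<close>,
  through the recursion of \<open>total_weight_Suc\<close>. The offset \<open>a\<close> is
  generalized because the later trees have offset \<open>a + m\<close>.\<close>

lemma total_weight_eq_coeff:
  fixes F :: "real fps fps"
  assumes r: "r \<ge> 1"
    and F: "F = 1 + fps_const fps_X * fps_X * F *
      fls_regpart ((\<Prod>i\<in>{..r}. 1 + fls_const (fps_const (x i)) * fls_X_inv) * fps_to_fls F)"
  shows "total_weight r x a n l = (F $ l) $ n"
proof -
  define e where "e j = fps_const (esym (Suc r) x j)" for j
  define H where "H = fls_regpart ((\<Prod>i\<in>{..r}. 1 + fls_const (fps_const (x i)) * fls_X_inv) * fps_to_fls F)"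
  have "(\<Prod>i<Suc r. 1 + fls_const (fps_const (x i)) * fls_X_inv) = (\<Sum>j\<le>Suc r. fls_const (e j) * fls_X_inv ^ j)"
    unfolding e_def
    by (rule prod_one_plus_esym) (simp_all add: fls_plus_const)
  \<comment> \<open>Multiplication by u^(-j) moves the coefficient of u^(p+j) to u^p, and
    \<open>fls_regpart\<close> retains p \<ge> 0.\<close>
  then have H: "H $ p = (\<Sum>j\<le>Suc r. e j * F $ (p + j))" for p
    by (simp add: H_def lessThan_Suc_atMost sum_distrib_right mult.assoc fls_nth_sum fls_X_inv_power_mult_nth nat_add_distrib
        del: sum.atMost_Suc)
  then have H': "(H $ p) $ m = (\<Sum>j\<le>Suc r. esym (Suc r) x j * (F $ (p + j)) $ m)" for p m
    by (simp add: e_def fps_sum_nth del: sum.atMost_Suc)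
  have F0: "F $ 0 = 1"
    by (subst F) (simp add: mult.assoc)
  have FS: "F $ Suc l = fps_X * (\<Sum>p\<le>l. H $ p * F $ (l - p))" for l
  proof -
    have "F = 1 + fps_const fps_X * (fps_X * (H * F))"
      using F unfolding H_def[symmetric] by (simp add: mult_ac)
    then have "F $ Suc l = (1 + fps_const fps_X * (fps_X * (H * F))) $ Suc l"
      by (rule arg_cong)
    also have "\<dots> = fps_X * (H * F) $ l"
      by simp
    finally show ?thesis
      by (simp add: fps_mult_nth atLeast0AtMost)
  qed
  show ?thesis
  proof (induction n arbitrary: a l rule: less_induct)
    case (less n)
    show ?case
    proof (cases n)
      case 0
      then show ?thesis
        by (cases l) (simp_all add: total_weight_0 F0 FS)
    next
      case (Suc n')
      have IH: "total_weight r x a m l = (F $ l) $ m" if "m \<le> n'" for a l m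
        using less that Suc by simp
      have "total_weight r x a (Suc n') l = (\<Sum>m\<le>n'. \<Sum>p<l. (H $ p) $ m * (F $ (l - 1 - p)) $ (n' - m))"
        unfolding total_weight_Suc[OF r] H' by (intro sum.cong refl) (simp add: IH del: sum.atMost_Suc)
      also have "\<dots> = (\<Sum>p<l. (H $ p * F $ (l - 1 - p)) $ n')"
        by (subst sum.swap) (simp add: fps_mult_nth atLeast0AtMost)
      also have "\<dots> = (F $ l) $ Suc n'"
        by (cases l) (simp_all add: F0 FS fps_sum_nth lessThan_Suc_atMost)
      finally show ?thesis
        by (simp add: Suc)
    qed
  qed
qed

section \<open>Comparing polynomials in the weights\<close>

text \<open>Induction on the variables, grouping monomials by the exponent of one of them.
  Injectivity says that distinct members of \<open>M\<close> are distinct exponent vectors on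
  \<open>I\<close>.\<close>

lemma multivariate_poly_zero:
  fixes c :: "('b \<Rightarrow> nat) \<Rightarrow> real"
  assumes "finite I" "finite M" "inj_on (\<lambda>k. restrict k I) M"
    and "\<And>x. (\<Sum>k\<in>M. c k * (\<Prod>i\<in>I. x i ^ k i)) = 0" and "k \<in> M"
  shows "c k = 0"
  using assms
proof (induction I arbitrary: M k rule: finite_induct)
  case empty
  then have "k' = k" if "k' \<in> M" for k'
    using that by (auto simp: inj_on_def)
  then have "M = {k}" using \<open>k \<in> M\<close> by blast
  then show ?case using empty(3) by simp
next
  case (insert i I)
  define P where "P x j = (\<Sum>k | k \<in> M \<and> k i = j. c k * (\<Prod>l\<in>I. x l ^ k l))" for x j
  define N where "N = (\<Sum>k\<in>M. k i)"
  have N: "k i \<le> N" if "k \<in> M" for k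
    unfolding N_def using member_le_sum[of k M "\<lambda>k. k i"] that insert.prems by auto
  have "P x j = 0" if "j \<le> N" for x j
  proof -
    have "(\<Sum>j\<le>N. P x j * t ^ j) = 0" for t
    proof -
      \<comment> \<open>Only the variable of \<open>i\<close> varies, so the hypothesis becomes a
        polynomial in \<open>t\<close> whose coefficients \<open>P x j\<close> do not involve
        it.\<close>
      let ?x = "x(i := t)"
      have "(\<Prod>l\<in>I. ?x l ^ k l) = (\<Prod>l\<in>I. x l ^ k l)" for k
        using insert.hyps by (intro prod.cong) auto
      then have term_eq: "(\<Prod>l\<in>insert i I. ?x l ^ k l) = t ^ k i * (\<Prod>l\<in>I. x l ^ k l)" for k
        using insert.hyps by simp
      have "(\<Sum>j\<le>N. P x j * t ^ j) = (\<Sum>j\<le>N. \<Sum>k | k \<in> M \<and> k i = j. c k * (\<Prod>l\<in>insert i I. ?x l ^ k l))"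
        unfolding P_def term_eq by (simp add: sum_distrib_right sum_distrib_left mult_ac)
      also have "\<dots> = (\<Sum>k\<in>M. c k * (\<Prod>l\<in>insert i I. ?x l ^ k l))"
        using N insert.prems(1) by (intro sum.group) auto
      also have "\<dots> = 0"
        by (rule insert.prems(3))
      finally show ?thesis .
    qed
    then show ?thesis
      using that polyfun_eq_0[of "P x" N] by auto
  qed
  then have P0: "P x (k i) = 0" for x
    using N insert.prems(4) by blast
  let ?M = "{k' \<in> M. k' i = k i}"
  have inj: "inj_on (\<lambda>k. restrict k I) ?M"
  proof (rule inj_onI)
    fix f g assume fg: "f \<in> ?M" "g \<in> ?M" "restrict f I = restrict g I"
    have "restrict f (insert i I) = restrict g (insert i I)"
    proof
      fix l
      show "restrict f (insert i I) l = restrict g (insert i I) l"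
        using fg(1,2) fun_cong[OF fg(3), of l] by (cases "l = i") (auto simp: restrict_def)
    qed
    then show "f = g"
      using inj_onD[OF insert.prems(2)] fg(1,2) by blast
  qed
  show ?case
    by (rule insert.IH[OF _ inj]) (use insert.prems P0 in \<open>auto simp: P_def\<close>)
qed

unbundle no fps_syntax

section \<open>The counted words as forests with one tree\<close>

lemma r_permutation_iff_multiperm:
  assumes "r \<ge> 1"
  shows "r_permutation r A w \<longleftrightarrow> multiperm r w \<and> set w = A"
proof -
  have "A \<subseteq> set w" if "r_permutation r A w"
  proof
    fix a assume "a \<in> A"
    then have "count_list w a \<noteq> 0"
      using that assms by (simp add: r_permutation_def)
    then show "a \<in> set w"
      by (simp add: count_list_0_iff)
  qed
  then show ?thesis
    by (auto simp: r_permutation_def)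
qed

lemma forests_1:
  assumes "r \<ge> 1" "n \<ge> 1"
  shows "forests r 0 n 1 = (\<lambda>w. [w]) ` {w. r_permutation r {1..n} w \<and> stack_sort (stack_sort w) = [1..<Suc n]}"
    (is "_ = _ ` ?C")
proof -
  have *: "forest r 0 n [w] \<longleftrightarrow>
      w \<noteq> [] \<and> multiperm r w \<and> distinct (stack_sort w) \<and> stack_sort (stack_sort w) = [1..<Suc n]" for w
    by (simp add: forest_def sortable_def del: upt_Suc)
  have "forest r 0 n [w] \<longleftrightarrow> w \<in> ?C" for w
  proof
    assume f: "forest r 0 n [w]"
    have "set w = {1..n}"
      using forest_set[OF f] atLeastLessThanSuc_atLeastAtMost[of 1 n] by simp
    then show "w \<in> ?C"
      using f unfolding * r_permutation_iff_multiperm[OF assms(1), of "{1..n}"] by blast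
  next
    assume "w \<in> ?C"
    then have w: "multiperm r w" "set w = {1..n}" "stack_sort (stack_sort w) = [1..<Suc n]"
      unfolding r_permutation_iff_multiperm[OF assms(1), of "{1..n}"] by blast+
    then have "w \<noteq> []" using assms(2) by auto
    then show "forest r 0 n [w]"
      unfolding * using w(1,3) distinct_stack_sort_multiperm[OF w(1) assms(1)] by blast
  qed
  moreover have "forests r 0 n 1 = (\<lambda>w. [w]) ` {w. forest r 0 n [w]}"
    unfolding forests_def by (force simp: length_Suc_conv image_iff)
  ultimately show ?thesis
    by simp
qed

theorem theorem4:
  fixes r n :: nat and k :: "nat \<Rightarrow> nat"
  assumes "r \<ge> 1"
    and "n = 1 + (\<Sum>i=0..r. k i)"
  shows "real (card {w. r_permutation r {1..n} w
                \<and> stack_sort (stack_sort w) = [1..<Suc n]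
                \<and> (\<forall>i\<in>{0..r}. card {a. type_descent w i a} = k i)})
         = 1 / real n ^ 2 *
           (\<Prod>i=0..r. real n / (real n - real (k i)) * real ((2 * n - 1 - k i) choose (k i)))"
proof -
  define C where "C = {w. r_permutation r {1..n} w \<and> stack_sort (stack_sort w) = [1..<Suc n]}"
  define K where "K = {f. f \<in> {..r} \<rightarrow>\<^sub>E {..n-1} \<and> sum f {..r} = n - 1}"
  define \<delta> where "\<delta> w = restrict (\<lambda>i. card {a. type_descent w i a}) {..r}" for w
  define val where "val f = 1 / real n ^ 2 *
      (\<Prod>i\<le>r. real n / (real n - real (f i)) * real ((2 * n - 1 - f i) choose (f i)))" for f :: "nat \<Rightarrow> nat"
  \<comment> \<open>\<open>M\<close> collects all exponent vectors on either side, observed or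
    predicted, so that both become sums over one finite set.\<close>
  define M where "M = \<delta> ` C \<union> K"
  have n: "n \<ge> 1" using assms(2) by simp
  have F1: "forests r 0 n 1 = (\<lambda>w. [w]) ` C"
    unfolding C_def by (rule forests_1[OF assms(1) n])
  have finC: "finite C"
    using finite_forests[of r 0 n 1] unfolding F1 by (rule finite_imageD) (simp add: inj_on_def)
  have finK: "finite K"
    unfolding K_def by (rule finite_subset[OF _ finite_PiE[of "{..r}" "\<lambda>_. {..n-1}"]]) auto
  have finM: "finite M" using finC finK by (simp add: M_def)
  define c where "c f = real (card {w \<in> C. \<delta> w = f}) - (if f \<in> K then val f else 0)" for f
  have "(\<Sum>f\<in>M. c f * (\<Prod>i\<in>{..r}. x i ^ f i)) = 0" for x
  proof -
    obtain F :: "real fps fps" where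
      F: "F = 1 + fps_const fps_X * fps_X * F *
        fls_regpart ((\<Prod>i\<in>{..r}. 1 + fls_const (fps_const (x i)) * fls_X_inv) * fps_to_fls F)"
      and coeff: "\<forall>n>0. fps_nth (fps_nth F 1) n = 1 / real n ^ 2 *
       (\<Sum>f | f \<in> {..r} \<rightarrow>\<^sub>E {..n-1} \<and> sum f {..r} = n - 1.
          \<Prod>i\<in>{..r}. x i ^ f i * (real n / (real n - real (f i)) * real ((2 * n - 1 - f i) choose (f i))))"
      using catalytic_solution_exists[of "{..r}" x] by auto
    have "(\<Sum>w\<in>C. word_weight r x w) = total_weight r x 0 n 1"
      unfolding total_weight_def F1 by (subst sum.reindex) (auto simp: inj_on_def forest_weight_def)
    also have "\<dots> = fps_nth (fps_nth F 1) n"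
      by (rule total_weight_eq_coeff[OF assms(1) F])
    also have "\<dots> = 1 / real n ^ 2 * (\<Sum>f\<in>K. \<Prod>i\<in>{..r}.
        x i ^ f i * (real n / (real n - real (f i)) * real ((2 * n - 1 - f i) choose (f i))))"
      unfolding K_def by (rule coeff[rule_format]) (use n in simp)
    also have "\<dots> = (\<Sum>f\<in>K. val f * (\<Prod>i\<in>{..r}. x i ^ f i))"
      by (simp only: sum_distrib_left val_def prod.distrib mult_ac)
    also have "\<dots> = (\<Sum>f\<in>M. (if f \<in> K then val f else 0) * (\<Prod>i\<in>{..r}. x i ^ f i))"
      using finM by (intro sum.mono_neutral_cong_left) (auto simp: M_def)
    finally have "(\<Sum>w\<in>C. word_weight r x w) = \<dots>" .
    moreover have "(\<Sum>w\<in>C. word_weight r x w) = (\<Sum>f\<in>M. \<Sum>w | w \<in> C \<and> \<delta> w = f. word_weight r x w)"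
      using finC finM by (intro sum.group[symmetric]) (auto simp: M_def)
    moreover have "(\<Sum>w | w \<in> C \<and> \<delta> w = f. word_weight r x w)
        = real (card {w \<in> C. \<delta> w = f}) * (\<Prod>i\<in>{..r}. x i ^ f i)" for f
    proof -
      have "word_weight r x w = (\<Prod>i\<in>{..r}. x i ^ \<delta> w i)" for w
        by (simp add: word_weight_def \<delta>_def)
      then show ?thesis by simp
    qed
    ultimately show ?thesis
      by (simp add: c_def left_diff_distrib sum_subtractf)
  qed
  moreover have "inj_on (\<lambda>f. restrict f {..r}) M"
  proof (rule inj_onI)
    fix f g assume "f \<in> M" "g \<in> M" "restrict f {..r} = restrict g {..r}"
    \<comment> \<open>Observed and predicted vectors are both extensional on
      \<open>{..r}\<close>.\<close>
    moreover have "restrict f {..r} = f" if "f \<in> M" for f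
      using that unfolding M_def \<delta>_def K_def by (auto simp: PiE_restrict)
    ultimately show "f = g" by metis
  qed
  ultimately have c0: "c f = 0" if "f \<in> M" for f
    using multivariate_poly_zero[OF finite_atMost finM] that by blast
  \<comment> \<open>\<open>k\<close> is arbitrary beyond \<open>r\<close>; its restriction is the
    representative lying in \<open>K\<close>.\<close>
  let ?k = "restrict k {..r}"
  have sum_k: "(\<Sum>i\<le>r. k i) = n - 1"
    using assms(2) by (simp add: atLeast0AtMost)
  have "k i \<le> n - 1" if "i \<le> r" for i
    using member_le_sum[of i "{..r}" k] that sum_k by simp
  then have "?k \<in> K"
    using sum_k by (simp add: K_def PiE_iff)
  then have "real (card {w \<in> C. \<delta> w = ?k}) = val ?k"
    using c0[of ?k] by (simp add: c_def M_def)
  moreover have "\<delta> w = ?k \<longleftrightarrow> (\<forall>i\<in>{0..r}. card {a. type_descent w i a} = k i)" for w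
    by (auto simp: \<delta>_def fun_eq_iff restrict_def)
  ultimately show ?thesis
    by (simp add: C_def val_def atLeast0AtMost conj_assoc)
qed

end
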